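(* Let $X, X_1, X_2, \ldots$ be i.i.d. real random variables with distribution $F$, let $S_n := X_1 + \cdots + X_n$ for $n \ge 1$, and, when $F \in \mathcal{F}_{3,\infty}$, let $\mu_3 := \mathbf{E}\, X^3$. For $n \ge 1$, $x \in \mathbb{R}$ and $\Delta > 0$, define $R_n = R_n(x,\Delta)$ (which also depends on $F$) by the relation $$ \frac{1}{\Delta}\, \mathbf{P}\bigl(S_n \in [x, x+\Delta)\bigr) = \frac{1}{n^{1/2}}\, \phi\Bigl(\frac{x}{n^{1/2}}\Bigr)\biggl(1 + \frac{\mu_3 x}{6n}\Bigl(\frac{x^2}{n} - 3\Bigr) - \frac{\Delta x}{2n}\biggr) + \frac{R_n(x,\Delta)}{n}. \qquad ( * ) $$ (i) For any distribution $F \in \mathcal{F}_{3,\infty}^1$, the remainder term in $( * )$ satisfies the following: there exists a $q \in (0,1)$ such that, for any fixed $\Delta_1 > 0$, $$ \lim_{n\to\infty}\ \sup_{q^n \le \Delta \le \Delta_1}\ \sup_{x \in \mathbb{R}} |R_n(x,\Delta)| = 0. $$ (ii) Moreover, for any fixed $r \in (3,4]$, $b \in (1,\infty)$ and $\rho \in (0,1)$, the remainder term in $( * )$ satisfies the following uniform bound over the class $\mathcal{F}_{r,b}^\rho$: there exists a $q \in (0,1)$ such that, for any fixed $\Delta_1 > 0$, $$ \limsup_{n\to\infty}\ \sup_{F \in \mathcal{F}_{r,b}^\rho}\ \sup_{q^n \le \Delta \le \Delta_1}\ \sup_{x \in \mathbb{R}}\ n^{(r-3)/2}\, |R_n(x,\Delta)|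 < \infty. $$
   Context: Notation: $\phi(t) := (2\pi)^{-1/2} e^{-t^2/2}$ is the standard normal density. For a random variable $X$ with distribution $F$, $\varphi(\lambda) := \mathbf{E}\, e^{i\lambda X}$, $\lambda \in \mathbb{R}$, is its characteristic function. For $r \in (2,\infty)$ and $b \in (1,\infty]$, $\mathcal{F}_{r,b}$ is the class of distributions $F$ on $\mathbb{R}$ such that, for $X \sim F$, one has $\mathbf{E}\, X = 0$, $\mathbf{E}\, X^2 = 1$ and $\mathbf{E}\, |X|^r < b$. In particular, $\mathcal{F}_{r,\infty}$ is the class of all zero mean, unit variance distributions with finite $r$th absolute moment. For $\rho \in (0,1]$ and $b < \infty$, $\mathcal{F}_{r,b}^\rho$ is the class of all distributions $F \in \mathcal{F}_{r,b}$ that satisfy $\sup_{|\lambda| > 1/b} |\varphi(\lambda)| < \rho$. When $b = \infty$, $\mathcal{F}_{r,\infty}^1$ is the class of all distributions $F \in \mathcal{F}_{r,\infty}$ that satisfy Cramér's strong non-lattice condition $\limsup_{|\lambda| \to \infty} |\varphi(\lambda)| < 1$ (equivalently, $\sup_{|\lambda| > \varepsilon} |\varphi(\lambda)| < 1$ for any $\varepsilon > 0$). In part (i), $q$ may depend on $F$; in part (ii), $q$ may depend on $r$, $b$, $\rho$ but not on the individual $F \in \mathcal{F}_{r,b}^\rho$. In both parts $q$ does not depend on $\Delta_1$. The supremum of a nonnegative quantity over an empty set is taken to be $0$. *)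

theory Defs
  imports "HOL-Probability.Probability"
begin

definition moment_class :: "real \<Rightarrow> ennreal \<Rightarrow> real measure set" where
  "moment_class r b = {F. real_distribution F \<and>
     has_bochner_integral F (\<lambda>x. x) 0 \<and>
     has_bochner_integral F (\<lambda>x. x\<^sup>2) 1 \<and>
     (\<integral>\<^sup>+ x. ennreal (\<bar>x\<bar> powr r) \<partial>F) < b}"

definition moment_char_class :: "real \<Rightarrow> real \<Rightarrow> real \<Rightarrow> real measure set" where
  "moment_char_class r b \<rho> =
     {F \<in> moment_class r (ennreal b). (SUP t\<in>{t. \<bar>t\<bar> > 1 / b}. cmod (char F t)) < \<rho>}"

(* The case of an infinite moment bound with \<rho> = 1: for the reals, at_infinity is the filter
   of \<bar>t\<bar> tending to infinity. *)
definition cramer_class :: "real \<Rightarrow> real measure set" where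
  "cramer_class r =
     {F \<in> moment_class r \<infinity>. Limsup at_infinity (\<lambda>t. ereal (cmod (char F t))) < 1}"

(* The i.i.d. sequence is realised by the coordinates of the infinite product of F; lemma
   iid_sum_prob_eq below shows that any other i.i.d. sequence gives the same sum_prob. *)
definition iid_space :: "real measure \<Rightarrow> (nat \<Rightarrow> real) measure" where
  "iid_space F = (\<Pi>\<^sub>M i\<in>UNIV. F)"

definition sum_prob :: "real measure \<Rightarrow> nat \<Rightarrow> real set \<Rightarrow> real" where
  "sum_prob F n A = measure (iid_space F) {\<omega> \<in> space (iid_space F). (\<Sum>i=1..n. \<omega> i) \<in> A}"

definition third_moment :: "real measure \<Rightarrow> real" where
  "third_moment F = (\<integral>x. x ^ 3 \<partial>F)"

definition expansion :: "real measure \<Rightarrow> nat \<Rightarrow> real \<Rightarrow> real \<Rightarrow> real" where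
  "expansion F n x \<Delta> =
     1 / sqrt n * std_normal_density (x / sqrt n) *
       (1 + third_moment F * x / (6 * n) * (x\<^sup>2 / n - 3) - \<Delta> * x / (2 * n))"

definition remainder :: "real measure \<Rightarrow> nat \<Rightarrow> real \<Rightarrow> real \<Rightarrow> real" where
  "remainder F n x \<Delta> = n * (1 / \<Delta> * sum_prob F n {x..<x + \<Delta>} - expansion F n x \<Delta>)"

lemma remainder_relation:
  assumes "n \<ge> 1"
  shows "1 / \<Delta> * sum_prob F n {x..<x + \<Delta>} = expansion F n x \<Delta> + remainder F n x \<Delta> / n"
  using assms by (simp add: remainder_def)

lemma iid_sum_prob_eq:
  fixes X :: "nat \<Rightarrow> 'a \<Rightarrow> real"
  assumes "prob_space M"
    and indep: "prob_space.indep_vars M (\<lambda>_. borel) X UNIV"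
    and law: "\<And>i. distr M borel (X i) = F"
    and A: "A \<in> sets borel"
  shows "measure M {\<omega> \<in> space M. (\<Sum>i=1..n. X i \<omega>) \<in> A} = sum_prob F n A"
proof -
  interpret prob_space M by fact
  have rv [measurable]: "X i \<in> borel_measurable M" for i
    using indep by (auto simp: indep_vars_def)
  have setsF: "sets F = sets borel"
    using law[of 0] by auto
  have eq: "distr M (\<Pi>\<^sub>M i\<in>UNIV. borel) (\<lambda>\<omega> i. X i \<omega>) = iid_space F"
    using indep_vars_iff_distr_eq_PiM[where I = "UNIV :: nat set" and M' = "\<lambda>_. borel" and X = X] indep rv law
    by (simp add: iid_space_def restrict_UNIV)
  have meas: "{\<omega> \<in> space (\<Pi>\<^sub>M i\<in>UNIV. borel). (\<Sum>i=1..n. \<omega> i) \<in> A}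
      \<in> sets (\<Pi>\<^sub>M i\<in>(UNIV::nat set). (borel :: real measure))"
    using A by measurable
  have mX: "(\<lambda>\<omega> i. X i \<omega>) \<in> measurable M (\<Pi>\<^sub>M i\<in>UNIV. borel)"
    by (rule measurable_PiM_single') (auto simp: space_PiM)
  show ?thesis
    unfolding sum_prob_def eq[symmetric]
    by (subst measure_distr) (use mX meas in \<open>auto simp: space_PiM intro!: arg_cong[where f="measure M"]\<close>)
qed

end

theory Submission
  imports Defs
begin

text \<open>
  Both parts rest on one estimate, \<open>edgeworth_remainder_bound\<close>: if \<open>F\<close> is standardised with
  third absolute moment at most \<open>b\<close>, and its characteristic function \<open>\<phi>\<close> is at most \<open>\<theta>\<^sup>4 < 1\<close> in
  modulus outside \<open>[-1/b, 1/b]\<close>, then for \<open>\<theta>\<^sup>n \<le> \<Delta> \<le> D\<close> the remainder is at most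
  \<open>C (n\<^sup>-\<^sup>1\<^sup>/\<^sup>2 + \<Psi>)\<close>, where \<open>C\<close> depends on \<open>b\<close>, \<open>\<theta>\<close>, \<open>D\<close> only and \<open>\<Psi>\<close> (\<open>cubic_error\<close>) is a Gaussian
  average of the error in the third order Taylor expansion of \<open>\<phi>\<close> at frequencies of order \<open>n\<^sup>-\<^sup>1\<^sup>/\<^sup>2\<close>.

  The proof of this estimate is Fourier analytic. The indicator of an interval has a Fourier transform
  that is not integrable, so \<open>S\<^sub>n\<close> is first perturbed by an independent uniform variable on an
  interval of the exponentially small length \<open>g = \<Delta> \<theta>\<^sup>n\<close>. Enlarging or shrinking the interval by \<open>g\<close>
  sandwiches the original probability (\<open>sum_prob_le_smoothed\<close>, \<open>smoothed_le_sum_prob\<close>), and the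
  inversion formula now reads
  \<open>P(S\<^sub>n + U \<in> (x, x+d]) / d = 1/(2\<pi>) \<integral> exp(-itx) w(t) \<kappa>(t) \<phi>(t)\<^sup>n dt\<close> with an integrable integrand,
  \<open>w\<close> and \<open>\<kappa>\<close> being the transforms of the interval and of the perturbation.
  The expansion is an integral of the same shape (\<open>expansion_fourier\<close>): its integrand is
  \<open>exp(-nt\<^sup>2/2) (1 - itd/2 + n \<mu>\<^sub>3 (it)\<^sup>3/6)\<close>, because multiplication by \<open>it\<close> corresponds, up to
  sign, to differentiating the normal density and so produces the Hermite polynomials. It remains to
  bound the \<open>L\<^sup>1\<close> distance of the two integrands, uniformly in \<open>x\<close>.

  For \<open>\<bar>t\<bar> \<le> 1/b\<close> the moment bound alone gives \<open>\<bar>\<phi>(t)\<bar> \<le> exp(-t\<^sup>2/3)\<close>, and expanding \<open>\<phi>\<^sup>n\<close> to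
  first order around \<open>\<phi> = exp(-t\<^sup>2/2)\<close> bounds the difference by a polynomial in \<open>t\<close> and \<open>n\<close> times
  \<open>exp(-nt\<^sup>2/3)\<close> (\<open>low_frequency_bound\<close>). For \<open>\<bar>t\<bar> > 1/b\<close> the factor \<open>\<bar>\<phi>\<bar>\<^sup>n \<le> \<theta>\<^sup>4\<^sup>n\<close> outweighs the loss
  \<open>1/(\<Delta> g) \<le> \<theta>\<^sup>-\<^sup>3\<^sup>n\<close> caused by short intervals (\<open>high_frequency_bound\<close>); this is why \<open>\<Delta>\<close> may be
  as small as \<open>\<theta>\<^sup>n\<close>, and the statement is proved with \<open>q = \<theta> = \<rho>\<^sup>1\<^sup>/\<^sup>4\<close>.

  For the uniform part, \<open>E\<bar>X\<bar>\<^sup>r < b\<close> implies \<open>E\<bar>X\<bar>\<^sup>3 \<le> b\<close> and \<open>\<Psi> = O(n\<^sup>-\<^sup>(\<^sup>r\<^sup>-\<^sup>3\<^sup>)\<^sup>/\<^sup>2)\<close>, and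
  the threshold \<open>1/b\<close> in the definition of the class is exactly where the low frequency bound stops. For a
  single distribution, \<open>\<Psi> \<longlonglongrightarrow> 0\<close> by dominated convergence, and Cramer's condition bounds \<open>\<bar>\<phi>\<bar>\<close> away
  from 1 outside every neighbourhood of 0 (\<open>char_bounded_away\<close>).
\<close>

section \<open>The law of a sum and its smoothing by a uniform variable\<close>

definition sum_law :: "real measure \<Rightarrow> nat \<Rightarrow> real measure" where
  "sum_law F n = distr (iid_space F) borel (\<lambda>\<omega>. \<Sum>i=1..n. \<omega> i)"

context real_distribution begin

lemma iid_sum_measurable [measurable]:
  "(\<lambda>\<omega>. \<Sum>i=1..n. \<omega> i) \<in> borel_measurable (iid_space M)"
  unfolding iid_space_def by measurable

lemma prob_space_iid_space: "prob_space (iid_space M)"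
  unfolding iid_space_def by (intro prob_space_PiM) (rule prob_space_axioms)

lemma real_distribution_sum_law: "real_distribution (sum_law M n)"
  unfolding sum_law_def
  by (intro prob_space.real_distribution_distr prob_space_iid_space iid_sum_measurable)

lemma sum_prob_eq_sum_law:
  "A \<in> sets borel \<Longrightarrow> sum_prob M n A = measure (sum_law M n) A"
  unfolding sum_prob_def sum_law_def
  by (subst measure_distr)
     (auto simp: vimage_def simp flip: One_nat_def intro!: arg_cong[where f="measure _"])

lemma char_sum_law: "char (sum_law M n) t = char M t ^ n"
proof -
  interpret P: prob_space "iid_space M" by (rule prob_space_iid_space)
  interpret PP: product_prob_space "\<lambda>_::nat. M" UNIV
    by standard
  have law: "distr (iid_space M) borel (\<lambda>\<omega>. \<omega> i) = M" for i
    using distr_PiM_component[of UNIV "\<lambda>_. M" i] prob_space_axioms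
    by (simp add: iid_space_def cong: distr_cong)
  have "P.indep_vars (\<lambda>_. borel) (\<lambda>i \<omega>. \<omega> i) UNIV"
  proof (subst P.indep_vars_iff_distr_eq_PiM)
    have "distr (iid_space M) (\<Pi>\<^sub>M i\<in>UNIV. borel) (\<lambda>x. restrict x UNIV)
        = distr (iid_space M) (iid_space M) (\<lambda>x. x)"
      by (intro distr_cong) (auto simp: iid_space_def intro!: sets_PiM_cong)
    then show "distr (iid_space M) (\<Pi>\<^sub>M i\<in>UNIV. borel) (\<lambda>x. \<lambda>i\<in>UNIV. x i)
        = (\<Pi>\<^sub>M i\<in>UNIV. distr (iid_space M) borel (\<lambda>\<omega>. \<omega> i))"
      by (simp add: law distr_id2) (simp add: iid_space_def)
  qed (auto simp: iid_space_def)
  then have "P.indep_vars (\<lambda>_. borel) (\<lambda>i \<omega>. \<omega> i) {1..n}"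
    by (rule P.indep_vars_subset) auto
  then show ?thesis
    unfolding sum_law_def by (simp add: P.char_distr_sum law)
qed

end

definition uniform_law :: "real \<Rightarrow> real \<Rightarrow> real measure" where
  "uniform_law a b = density lborel (\<lambda>u. ennreal (indicator {a..b} u / (b - a)))"

context
  fixes a b :: real
  assumes ab: "a < b"
begin

lemma real_distribution_uniform_law: "real_distribution (uniform_law a b)"
proof -
  have "emeasure (uniform_law a b) UNIV = 1"
  proof -
    have "emeasure (uniform_law a b) UNIV = (\<integral>\<^sup>+u. ennreal (1/(b-a)) * indicator {a..b} u \<partial>lborel)"
      unfolding uniform_law_def by (subst emeasure_density) (auto intro!: nn_integral_cong split: split_indicator)
    also have "\<dots> = 1"
      using ab by (simp add: nn_integral_cmult ennreal_mult[symmetric])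
    finally show ?thesis .
  qed
  then show ?thesis
    by (auto simp: real_distribution_def real_distribution_axioms_def uniform_law_def intro!: prob_spaceI)
qed

lemma AE_uniform_law: "AE u in uniform_law a b. a < u \<and> u \<le> b"
  unfolding uniform_law_def using AE_lborel_singleton[of a]
  by (subst AE_density) (auto split: split_indicator elim!: eventually_mono)

lemma uniform_law_singleton: "measure (uniform_law a b) {s} = 0"
proof -
  have "emeasure (uniform_law a b) {s} = (\<integral>\<^sup>+u. ennreal (indicator {a..b} s/(b-a)) * indicator {s} u \<partial>lborel)"
    unfolding uniform_law_def by (subst emeasure_density) (auto intro!: nn_integral_cong split: split_indicator)
  also have "\<dots> = 0" by (simp add: nn_integral_cmult)
  finally show ?thesis by (simp add: measure_def)
qed

text \<open>The decay of order \<open>1/\<bar>t\<bar>\<close>, together with that of \<open>interval_kernel\<close>, makes the integrand of the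
  inversion formula absolutely integrable.\<close>

lemma char_uniform_law_bound:
  assumes "t \<noteq> 0"
  shows "cmod (char (uniform_law a b) t) \<le> 2 / ((b - a) * \<bar>t\<bar>)"
proof -
  have "char (uniform_law a b) t = (CLINT u|lborel. (indicator {a..b} u / (b - a)) *\<^sub>R iexp (t * u))"
    unfolding char_def uniform_law_def using ab by (subst integral_density) auto
  also have "\<dots> = (1/(b-a)) *\<^sub>R (CLINT u|lborel. indicator {a..b} u *\<^sub>R iexp (t * u))"
    by (subst integral_scaleR_right[symmetric]) (auto intro!: Bochner_Integration.integral_cong)
  also have "(CLINT u|lborel. indicator {a..b} u *\<^sub>R iexp (t * u)) = iexp (t*b) / (\<i> * t) - iexp (t*a) / (\<i> * t)"
  proof (rule integral_FTC_atLeastAtMost)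
    fix x
    have "((\<lambda>u. exp (\<i> * (complex_of_real t * u)) / (\<i> * complex_of_real t)) has_field_derivative exp (\<i> * (t * x))) (at (of_real x))"
      using assms by (auto intro!: derivative_eq_intros simp: field_simps)
    from has_vector_derivative_real_field[OF this, of "{a..b}"]
    show "((\<lambda>u. iexp (t * u) / (\<i> * t)) has_vector_derivative iexp (t * x)) (at x within {a..b})"
      by simp
  qed (use ab in \<open>auto intro!: continuous_intros\<close>)
  finally have "cmod (char (uniform_law a b) t)
      = (1/(b-a)) * cmod (iexp (t*b) / (\<i> * t) - iexp (t*a) / (\<i> * t))"
    using ab by (simp del: of_real_mult)
  also have "\<dots> \<le> (1/(b-a)) * (cmod (iexp (t*b) / (\<i> * t)) + cmod (iexp (t*a) / (\<i> * t)))"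
    using ab by (intro mult_left_mono norm_triangle_ineq4) auto
  also have "\<dots> = 2 / ((b - a) * \<bar>t\<bar>)"
    by (simp add: norm_divide norm_mult del: of_real_mult)
  finally show ?thesis .
qed

text \<open>The perturbation has size at most \<open>g\<close>, so at low frequencies it changes the characteristic function
  by no more than its first absolute moment allows.\<close>

lemma char_uniform_law_near_1:
  assumes "\<bar>a\<bar> \<le> g" "\<bar>b\<bar> \<le> g"
  shows "cmod (char (uniform_law a b) t - 1) \<le> g * \<bar>t\<bar>"
proof -
  interpret real_distribution "uniform_law a b" by (rule real_distribution_uniform_law)
  have p1: "measure (uniform_law a b) UNIV = 1" using prob_space by simp
  have "cmod (char (uniform_law a b) t - 1) \<le> expectation (\<lambda>x. min 2 (\<bar>t\<bar> * \<bar>x\<bar>))"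
    using char_approx2[of 0 t] by (simp add: p1)
  also have "\<dots> \<le> expectation (\<lambda>x. g * \<bar>t\<bar>)"
  proof (rule integral_mono_AE)
    show "AE x in uniform_law a b. min 2 (\<bar>t\<bar> * \<bar>x\<bar>) \<le> g * \<bar>t\<bar>"
      using AE_uniform_law
    proof eventually_elim
      case (elim x)
      then have "\<bar>x\<bar> \<le> g" using assms by linarith
      then have "\<bar>t\<bar> * \<bar>x\<bar> \<le> \<bar>t\<bar> * g" by (intro mult_left_mono) auto
      then show ?case by (simp add: mult.commute)
    qed
    show "integrable (uniform_law a b) (\<lambda>x. min 2 (\<bar>t\<bar> * \<bar>x\<bar>))"
      by (rule integrable_const_bound[of _ 2]) auto
  qed auto
  also have "\<dots> = g * \<bar>t\<bar>" by (simp add: p1)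
  finally show ?thesis .
qed

end

definition smoothed_law :: "real measure \<Rightarrow> real measure \<Rightarrow> real measure" where
  "smoothed_law M K = distr (M \<Otimes>\<^sub>M K) borel (\<lambda>(s, u). s + u)"

context
  fixes M K :: "real measure"
  assumes M: "real_distribution M" and K: "real_distribution K"
begin

interpretation M: real_distribution M by (rule M)
interpretation K: real_distribution K by (rule K)
interpretation P: pair_prob_space M K ..

lemma distr_fst: "distr (M \<Otimes>\<^sub>M K) borel fst = M"
proof (rule measure_eqI)
  fix A assume "A \<in> sets (distr (M \<Otimes>\<^sub>M K) borel fst)"
  then have [measurable]: "A \<in> sets borel" by simp
  have "fst -` A \<inter> space (M \<Otimes>\<^sub>M K) = A \<times> UNIV"
    by (auto simp: space_pair_measure)
  then show "emeasure (distr (M \<Otimes>\<^sub>M K) borel fst) A = emeasure M A"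
    using K.emeasure_space_1
    by (subst emeasure_distr) (auto simp: K.emeasure_pair_measure_Times intro!: measurable_fst'')
qed simp

lemma distr_snd: "distr (M \<Otimes>\<^sub>M K) borel snd = K"
proof (rule measure_eqI)
  fix A assume "A \<in> sets (distr (M \<Otimes>\<^sub>M K) borel snd)"
  then have [measurable]: "A \<in> sets borel" by simp
  have "snd -` A \<inter> space (M \<Otimes>\<^sub>M K) = UNIV \<times> A"
    by (auto simp: space_pair_measure)
  then show "emeasure (distr (M \<Otimes>\<^sub>M K) borel snd) A = emeasure K A"
    using M.emeasure_space_1
    by (subst emeasure_distr) (auto simp: K.emeasure_pair_measure_Times intro!: measurable_snd'')
qed simp

lemma smoothed_law_measurable: "(\<lambda>(s, u). s + u) \<in> borel_measurable (M \<Otimes>\<^sub>M K)"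
  by measurable

lemma real_distribution_smoothed_law: "real_distribution (smoothed_law M K)"
  unfolding smoothed_law_def by (intro P.real_distribution_distr smoothed_law_measurable)

lemma char_smoothed_law: "char (smoothed_law M K) t = char M t * char K t"
proof -
  have "P.indep_var borel fst borel snd"
    unfolding P.indep_var_distribution_eq distr_fst distr_snd
    by (auto intro!: distr_id2[symmetric] sets_pair_measure_cong)
  from P.char_distr_add[OF this, of t] show ?thesis
    by (simp add: smoothed_law_def case_prod_beta' distr_fst distr_snd)
qed

lemma measure_smoothed_law:
  assumes "A \<in> sets borel"
  shows "measure (smoothed_law M K) A = measure (M \<Otimes>\<^sub>M K) {p\<in>space (M \<Otimes>\<^sub>M K). fst p + snd p \<in> A}"
  unfolding smoothed_law_def using assms
  by (subst measure_distr) (auto intro!: arg_cong[where f="measure _"] simp: case_prod_beta')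

lemma measure_first_law:
  assumes "A \<in> sets borel"
  shows "measure M A = measure (M \<Otimes>\<^sub>M K) {p\<in>space (M \<Otimes>\<^sub>M K). fst p \<in> A}"
proof -
  have "measure (distr (M \<Otimes>\<^sub>M K) borel fst) A
      = measure (M \<Otimes>\<^sub>M K) {p\<in>space (M \<Otimes>\<^sub>M K). fst p \<in> A}"
    using assms by (subst measure_distr) (auto intro!: arg_cong[where f="measure _"])
  then show ?thesis by (simp add: distr_fst)
qed

text \<open>An independent summand with continuous distribution removes all atoms; the inversion formula
  therefore holds at every endpoint.\<close>

lemma smoothed_law_singleton:
  assumes "\<And>s. measure K {s} = 0"
  shows "measure (smoothed_law M K) {x} = 0"
proof -
  have meas: "{p\<in>space (M \<Otimes>\<^sub>M K). fst p + snd p \<in> {x}} \<in> sets (M \<Otimes>\<^sub>M K)"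
    by measurable
  have "emeasure (M \<Otimes>\<^sub>M K) {p\<in>space (M \<Otimes>\<^sub>M K). fst p + snd p \<in> {x}}
      = (\<integral>\<^sup>+ s. emeasure K (Pair s -` {p\<in>space (M \<Otimes>\<^sub>M K). fst p + snd p \<in> {x}}) \<partial>M)"
    using meas by (rule K.emeasure_pair_measure_alt)
  also have "\<dots> = (\<integral>\<^sup>+ s. 0 \<partial>M)"
  proof (rule nn_integral_cong)
    fix s
    have "Pair s -` {p\<in>space (M \<Otimes>\<^sub>M K). fst p + snd p \<in> {x}} = {x - s}"
      by (auto simp: space_pair_measure)
    then show "emeasure K (Pair s -` {p\<in>space (M \<Otimes>\<^sub>M K). fst p + snd p \<in> {x}}) = 0"
      using assms by (simp add: K.emeasure_eq_measure)
  qed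
  finally show ?thesis
    by (subst measure_smoothed_law) (auto simp: measure_def)
qed

lemma AE_second_law:
  assumes "AE u in K. Q u"
  shows "AE p in M \<Otimes>\<^sub>M K. Q (snd p)"
proof (rule AE_distrD[of snd _ borel])
  show "AE u in distr (M \<Otimes>\<^sub>M K) borel snd. Q u"
    unfolding distr_snd by (rule assms)
qed simp

lemma measure_le_smoothed_law:
  assumes "AE u in K. \<forall>s\<in>A. s + u \<in> B" and [measurable]: "A \<in> sets borel" "B \<in> sets borel"
  shows "measure M A \<le> measure (smoothed_law M K) B"
  unfolding measure_smoothed_law[OF assms(3)] measure_first_law[OF assms(2)]
proof (rule P.finite_measure_mono_AE)
  show "AE p in M \<Otimes>\<^sub>M K. p \<in> {p\<in>space (M \<Otimes>\<^sub>M K). fst p \<in> A}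
      \<longrightarrow> p \<in> {p\<in>space (M \<Otimes>\<^sub>M K). fst p + snd p \<in> B}"
    using AE_second_law[OF assms(1)] by eventually_elim auto
qed measurable

lemma smoothed_law_le_measure:
  assumes "AE u in K. \<forall>s. s + u \<in> B \<longrightarrow> s \<in> A" and [measurable]: "A \<in> sets borel" "B \<in> sets borel"
  shows "measure (smoothed_law M K) B \<le> measure M A"
  unfolding measure_smoothed_law[OF assms(3)] measure_first_law[OF assms(2)]
proof (rule P.finite_measure_mono_AE)
  show "AE p in M \<Otimes>\<^sub>M K. p \<in> {p\<in>space (M \<Otimes>\<^sub>M K). fst p + snd p \<in> B}
      \<longrightarrow> p \<in> {p\<in>space (M \<Otimes>\<^sub>M K). fst p \<in> A}"
    using AE_second_law[OF assms(1)] by eventually_elim auto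
qed measurable

end

section \<open>Fourier inversion for interval probabilities\<close>

text \<open>The characteristic function at \<open>-t\<close> of the uniform distribution on \<open>[0, d]\<close>. The value at
  \<open>t = 0\<close> is 0 by division by zero instead of the limit 1; this affects a null set only.\<close>

definition interval_kernel :: "real \<Rightarrow> real \<Rightarrow> complex" where
  "interval_kernel d t = (1 - iexp (- (t * d))) / (\<i> * t * d)"

lemma interval_kernel_measurable [measurable]: "interval_kernel d \<in> borel_measurable borel"
  unfolding interval_kernel_def by measurable

text \<open>Levy's inversion theorem gives a limit of integrals over \<open>[-T, T]\<close>; integrability turns it into an
  integral over the whole line.\<close>

lemma (in real_distribution) interval_prob_fourier:
  assumes d: "0 < d" and atoms: "\<And>a. measure M {a} = 0"
    and int: "integrable lborel (\<lambda>t. iexp (- (t * x)) * interval_kernel d t * char M t)"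
  shows "complex_of_real (measure M {x<..x+d} / d)
    = 1 / (2 * pi) * (CLINT t|lborel. iexp (- (t * x)) * interval_kernel d t * char M t)"
proof -
  let ?f = "\<lambda>t. iexp (- (t * x)) * interval_kernel d t * char M t"
  let ?g = "\<lambda>t. (iexp (-(t * x)) - iexp (-(t * (x+d)))) / (\<i> * t) * char M t"
  have eq: "?g t = d * ?f t" for t
    using d by (cases "t = 0") (simp_all add: interval_kernel_def field_simps exp_add exp_diff exp_minus)
  have "(\<lambda>T. 1 / (2 * pi) * (CLBINT t=-T..T. ?g t)) \<longlonglongrightarrow> complex_of_real (measure M {x<..x+d})"
    using Levy_Inversion[of x "x+d"] d atoms by simp
  then have lim1: "(\<lambda>T::nat. 1 / (2 * pi) * (CLBINT t=ereal (- real T)..ereal (real T). d * ?f t)) \<longlonglongrightarrow> complex_of_real (measure M {x<..x+d})"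
    unfolding eq by simp
  have "(\<lambda>T::nat. CLINT t|lborel. indicator {-real T..real T} t *\<^sub>R (d * ?f t)) \<longlonglongrightarrow> (CLINT t|lborel. d * ?f t)"
  proof (rule integral_dominated_convergence[where w="\<lambda>t. norm (d * ?f t)"])
    show "integrable lborel (\<lambda>t. norm (d * ?f t))" using int by (intro integrable_norm integrable_mult_right)
    show "AE t in lborel. (\<lambda>T::nat. indicator {-real T..real T} t *\<^sub>R (d * ?f t)) \<longlonglongrightarrow> d * ?f t"
    proof (rule AE_I2)
      fix t :: real
      obtain N :: nat where "\<bar>t\<bar> \<le> N" using real_arch_simple by blast
      then have "\<forall>\<^sub>F T in sequentially. indicator {-real T..T} t *\<^sub>R (d * ?f t) = d * ?f t"
        by (intro eventually_sequentiallyI[of N]) (auto split: split_indicator)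
      then show "(\<lambda>T::nat. indicator {-real T..real T} t *\<^sub>R (d * ?f t)) \<longlonglongrightarrow> d * ?f t"
        by (rule tendsto_eventually)
    qed
    show "AE t in lborel. norm (indicator {-real T..T} t *\<^sub>R (d * ?f t)) \<le> norm (d * ?f t)" for T :: nat
      by (auto split: split_indicator)
  qed (use int in \<open>auto dest: borel_measurable_integrable\<close>)
  also have "(\<lambda>T::nat. CLINT t|lborel. indicator {-real T..real T} t *\<^sub>R (d * ?f t)) = (\<lambda>T::nat. CLBINT t=ereal (- real T)..ereal (real T). d * ?f t)"
    by (rule ext, subst interval_integral_Icc) (simp, simp only: set_lebesgue_integral_def)
  finally have "(\<lambda>T::nat. 1 / (2 * pi) * (CLBINT t=ereal (- real T)..ereal (real T). d * ?f t)) \<longlonglongrightarrow> 1 / (2 * pi) * (CLINT t|lborel. d * ?f t)"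
    by (intro tendsto_intros)
  from LIMSEQ_unique[OF lim1 this] show ?thesis
    using d by (simp add: field_simps)
qed

lemma interval_kernel_bound:
  assumes "0 < d" "t \<noteq> 0"
  shows "cmod (interval_kernel d t) \<le> 2 / (d * \<bar>t\<bar>)"
proof -
  have "cmod (1 - iexp (- (t * d))) \<le> 2"
    using norm_triangle_ineq4[of 1 "iexp (- (t * d))"] norm_exp_i_times[of "-(t*d)"] by simp
  then have "cmod (1 - iexp (- (t * d))) / (\<bar>t\<bar> * d) \<le> 2 / (\<bar>t\<bar> * d)"
    using assms by (intro divide_right_mono) auto
  then show ?thesis
    unfolding interval_kernel_def using assms by (simp add: norm_divide norm_mult mult.commute)
qed

lemma interval_kernel_approx:
  assumes "0 < d" "t \<noteq> 0"
  shows "cmod (interval_kernel d t - (1 - \<i> * t * d / 2)) \<le> (t * d)\<^sup>2 / 6"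
proof -
  have eq: "interval_kernel d t - (1 - \<i> * t * d / 2)
      = - (iexp (- (t * d)) - (\<Sum>k\<le>2. (\<i> * complex_of_real (- (t * d)))^k / fact k)) / (\<i> * t * d)"
    using assms
    by (simp add: interval_kernel_def eval_nat_numeral divide_simps) (simp add: algebra_simps)
  show ?thesis
    unfolding eq using iexp_approx1[of "-(t*d)" 2] assms
    by (simp add: norm_divide norm_mult eval_nat_numeral divide_simps abs_mult del: of_real_mult of_real_minus)
      (simp add: algebra_simps)
qed

section \<open>The expansion as a Fourier integral\<close>

definition gauss_moment :: "real \<Rightarrow> nat \<Rightarrow> complex" where
  "gauss_moment y k = (CLINT s|lborel. (exp (- s\<^sup>2 / 2) * s ^ k) *\<^sub>R iexp (- (s * y)))"

lemma integrable_exp_power: "integrable lborel (\<lambda>s::real. exp (- s\<^sup>2 / 2) * s ^ k)"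
proof -
  have "integrable lborel (\<lambda>s::real. sqrt (2 * pi) * (std_normal_density s * s ^ k))"
    by (intro integrable_mult_right integrable_std_normal_moment)
  then show ?thesis by (simp add: std_normal_density_def)
qed

lemma integrable_gauss_moment:
  "integrable lborel (\<lambda>s::real. (exp (- s\<^sup>2 / 2) * s ^ k) *\<^sub>R iexp (- (s * y)))"
  by (rule Bochner_Integration.integrable_bound[OF integrable_exp_power[of k]]) auto

lemma gauss_moment_0: "gauss_moment y 0 = sqrt (2 * pi) * exp (- y\<^sup>2 / 2)"
proof -
  have "char std_normal_distribution (- y) = (CLINT s|lborel. std_normal_density s *\<^sub>R iexp (- (s * y)))"
    unfolding char_def by (subst integral_density) (auto simp: mult.commute)
  also have "\<dots> = (1 / sqrt (2 * pi)) *\<^sub>R gauss_moment y 0"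
    unfolding gauss_moment_def
    by (subst integral_scaleR_right[symmetric]) (simp add: std_normal_density_def)
  finally show ?thesis
    by (simp add: char_std_normal_distribution scaleR_conv_of_real field_simps)
qed

lemma exp_power_tendsto_0: "((\<lambda>s::real. exp (- s\<^sup>2 / 2) * s ^ k) \<longlongrightarrow> 0) at_infinity"
proof (rule Lim_null_comparison)
  have bound: "norm (exp (- s\<^sup>2 / 2) * s ^ k) \<le> norm s ^ k / exp (norm s)" if "2 \<le> norm s" for s :: real
  proof -
    have "2 * \<bar>s\<bar> \<le> \<bar>s\<bar> * \<bar>s\<bar>" using that by (intro mult_right_mono) auto
    then have "exp (- s\<^sup>2 / 2) \<le> exp (- \<bar>s\<bar>)" by (simp add: power2_eq_square)
    then have "exp (- s\<^sup>2 / 2) * \<bar>s\<bar> ^ k \<le> exp (- \<bar>s\<bar>) * \<bar>s\<bar> ^ k" by (intro mult_right_mono) auto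
    then show ?thesis by (simp add: abs_mult power_abs exp_minus field_simps)
  qed
  then show "\<forall>\<^sub>F s::real in at_infinity. norm (exp (- s\<^sup>2 / 2) * s ^ k) \<le> norm s ^ k / exp (norm s)"
    unfolding eventually_at_infinity by blast
  have "((\<lambda>x::real. x ^ k / exp x) \<longlongrightarrow> 0) at_top"
    by (rule tendsto_power_div_exp_0)
  from filterlim_compose[OF this filterlim_norm_at_top]
  show "((\<lambda>s::real. norm s ^ k / exp (norm s)) \<longlongrightarrow> 0) at_infinity" .
qed

text \<open>Integration by parts: the derivative of \<open>s\<^sup>k exp(-s\<^sup>2/2) exp(-isy)\<close> integrates to 0 because the
  function vanishes at both ends. This is the three term recursion of the Hermite polynomials; for
  \<open>k = 0\<close> the truncated \<open>k - 1\<close> is multiplied by 0.\<close>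

lemma gauss_moment_Suc:
  "gauss_moment y (Suc k) = k * gauss_moment y (k - 1) - \<i> * y * gauss_moment y k"
proof -
  define f where "f s = k *\<^sub>R ((exp (- s\<^sup>2 / 2) * s ^ (k - 1)) *\<^sub>R iexp (- (s * y)))
     - ((exp (- s\<^sup>2 / 2) * s ^ Suc k) *\<^sub>R iexp (- (s * y)))
     - (\<i> * y) * ((exp (- s\<^sup>2 / 2) * s ^ k) *\<^sub>R iexp (- (s * y)))" for s
  define G where "G s = (exp (- s\<^sup>2 / 2) * s ^ k) *\<^sub>R iexp (- (s * y))" for s
  have int: "integrable lborel f"
    unfolding f_def
    by (intro Bochner_Integration.integrable_diff integrable_mult_right integrable_scaleR_right
        integrable_gauss_moment)
  have deriv: "(G has_vector_derivative f s) (at s)" for s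
  proof -
    have 1: "((\<lambda>s. exp (- s\<^sup>2 / 2) * s ^ k) has_real_derivative
       k * (exp (- s\<^sup>2 / 2) * s ^ (k - 1)) - exp (- s\<^sup>2 / 2) * s ^ Suc k) (at s)"
      by (auto intro!: derivative_eq_intros simp: algebra_simps)
    have 2: "((\<lambda>s. iexp (- (s * y))) has_vector_derivative (- y) *\<^sub>R (\<i> * iexp (- (s * y)))) (at s)"
    proof -
      have "((\<lambda>z. exp (- (\<i> * (z * complex_of_real y)))) has_field_derivative
          - (\<i> * y) * exp (- (\<i> * (complex_of_real s * y)))) (at (complex_of_real s))"
        by (auto intro!: derivative_eq_intros)
      from has_vector_derivative_real_field[OF this, of UNIV] show ?thesis
        by (simp add: scaleR_conv_of_real mult_ac)
    qed
    show ?thesis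
      unfolding G_def[abs_def]
      by (rule has_vector_derivative_eq_rhs[OF has_vector_derivative_scaleR[OF 1 2]])
        (simp add: f_def scaleR_conv_of_real algebra_simps)
  qed
  have "(LBINT s=-\<infinity>..\<infinity>. f s) = 0 - 0"
  proof (rule interval_integral_FTC_integrable[where F = G])
    show "isCont f s" for s
      unfolding f_def by (intro continuous_intros) auto
    have "((\<lambda>s. norm (G s)) \<longlongrightarrow> 0) at_top" "((\<lambda>s. norm (G s)) \<longlongrightarrow> 0) at_bot"
      using tendsto_norm_zero[OF tendsto_mono[OF at_top_le_at_infinity exp_power_tendsto_0[of k]]]
        tendsto_norm_zero[OF tendsto_mono[OF at_bot_le_at_infinity exp_power_tendsto_0[of k]]]
      by (simp_all add: G_def abs_mult)
    then show "((G \<circ> real_of_ereal) \<longlongrightarrow> 0) (at_right (-\<infinity>))" "((G \<circ> real_of_ereal) \<longlongrightarrow> 0) (at_left \<infinity>)"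
      by (simp_all add: ereal_tendsto_simps tendsto_norm_zero_iff)
    show "set_integrable lborel (einterval (-\<infinity>) \<infinity>) f"
      using int by (simp add: set_integrable_def)
  qed (auto simp: deriv)
  then have "integral\<^sup>L lborel f = 0"
    by (simp add: interval_lebesgue_integral_def set_lebesgue_integral_def)
  moreover have "integral\<^sup>L lborel f = k * gauss_moment y (k - 1) - gauss_moment y (Suc k) - \<i> * y * gauss_moment y k"
    unfolding f_def gauss_moment_def
    by (subst Bochner_Integration.integral_diff; (intro Bochner_Integration.integrable_diff integrable_mult_right integrable_scaleR_right
        integrable_gauss_moment)?)+ (simp add: scaleR_conv_of_real)
  ultimately show ?thesis by (simp add: algebra_simps)
qed

text \<open>The first order Edgeworth approximation to \<open>\<phi>\<^sup>n\<close>, multiplied by the linear approximation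
  \<open>1 - itd/2\<close> of \<open>interval_kernel\<close>, without the product of the two correction terms, which is of the order
  of the error.\<close>

definition edgeworth_char :: "real \<Rightarrow> nat \<Rightarrow> real \<Rightarrow> real \<Rightarrow> complex" where
  "edgeworth_char \<mu> n d t = complex_of_real (exp (- real n * t\<^sup>2 / 2)) * (1 - \<i> * t * d / 2 + complex_of_real (real n * \<mu>) * (\<i> * t) ^ 3 / 6)"

text \<open>At frequency \<open>s / sqrt n\<close> and position \<open>y sqrt n\<close> all powers of \<open>n\<close> collect into the two
  correction coefficients of order \<open>n\<^sup>-\<^sup>1\<^sup>/\<^sup>2\<close>.\<close>

lemma edgeworth_char_scaled:
  assumes n: "0 < n"
  shows "iexp (- (s / sqrt n * (y * sqrt n))) * edgeworth_char \<mu> n d (s / sqrt n)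
    = (exp (- s\<^sup>2 / 2) * s ^ 0) *\<^sub>R iexp (- (s * y))
      - (\<i> * d / (2 * sqrt n)) * ((exp (- s\<^sup>2 / 2) * s ^ 1) *\<^sub>R iexp (- (s * y)))
      - (\<i> * \<mu> / (6 * sqrt n)) * ((exp (- s\<^sup>2 / 2) * s ^ 3) *\<^sub>R iexp (- (s * y)))"
proof -
  have sq: "complex_of_real (sqrt n) * complex_of_real (sqrt n) = n" "complex_of_real (sqrt n) \<noteq> 0"
    using n by (simp_all flip: of_real_mult)
  have e: "- real n * (s / sqrt n)\<^sup>2 / 2 = - s\<^sup>2 / 2" "s / sqrt n * (y * sqrt n) = s * y"
    using n by (simp_all add: power_divide)
  define w where "w = complex_of_real (sqrt n)"
  have nw: "complex_of_real (real n) = w * w" "w \<noteq> 0" using sq by (simp_all add: w_def)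
  have i3: "\<i> ^ 3 = - \<i>" by (simp add: eval_nat_numeral)
  have "complex_of_real (real n * \<mu>) * (\<i> * (s / w)) ^ 3 / 6 = - (\<i> * \<mu> / (6 * w)) * s ^ 3"
    unfolding of_real_mult nw(1) using nw(2) by (simp add: i3 power_mult_distrib power_divide field_simps power3_eq_cube)
  moreover have "\<i> * (s / w) * d / 2 = (\<i> * d / (2 * w)) * s" by (simp add: field_simps)
  ultimately show ?thesis
    unfolding edgeworth_char_def e w_def of_real_divide
    by (simp only: scaleR_conv_of_real) (simp add: algebra_simps)
qed

lemma expansion_normalised:
  fixes x d :: real and n :: nat
  assumes n: "0 < n"
  defines "y \<equiv> x / sqrt n"
  shows "expansion F n x d = 1 / sqrt n * std_normal_density y *
       (1 - d * y / (2 * sqrt n) + third_moment F * (y^3 - 3 * y) / (6 * sqrt n))"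
proof -
  define w where "w = sqrt n"
  have w: "real n = w * w" "w > 0" using n by (simp_all add: w_def)
  have x: "x = y * w" using n by (simp add: y_def w_def)
  have "third_moment F * x / (6 * n) * (x\<^sup>2 / n - 3) = third_moment F * (y^3 - 3 * y) / (6 * sqrt n)"
    "d * x / (2 * n) = d * y / (2 * sqrt n)"
    unfolding x w_def[symmetric] w(1) using w(2)
    by (simp_all add: w(1) power_mult_distrib field_simps power3_eq_cube power2_eq_square)
  then show ?thesis unfolding expansion_def y_def[symmetric] by simp
qed

text \<open>After the scaling above the three terms are the Gaussian moments of order 0, 1 and 3, and the
  recursion turns these into the Hermite polynomials 1, \<open>y\<close> and \<open>y\<^sup>3 - 3y\<close> of the expansion.\<close>

lemma
  assumes n: "0 < n"
  shows integrable_edgeworth_char: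
      "integrable lborel (\<lambda>t. iexp (- (t * x)) * edgeworth_char (third_moment F) n d t)"
    and expansion_fourier: "complex_of_real (expansion F n x d)
     = 1 / (2 * pi) * (CLINT t|lborel. iexp (- (t * x)) * edgeworth_char (third_moment F) n d t)"
proof -
  let ?\<mu> = "third_moment F"
  define y where "y = x / sqrt n"
  have x: "x = y * sqrt n" using n by (simp add: y_def)
  let ?f = "\<lambda>t. iexp (- (t * x)) * edgeworth_char ?\<mu> n d t"
  let ?g = "\<lambda>s. (exp (- s\<^sup>2 / 2) * s ^ 0) *\<^sub>R iexp (- (s * y))
      - (\<i> * d / (2 * sqrt n)) * ((exp (- s\<^sup>2 / 2) * s ^ 1) *\<^sub>R iexp (- (s * y)))
      - (\<i> * ?\<mu> / (6 * sqrt n)) * ((exp (- s\<^sup>2 / 2) * s ^ 3) *\<^sub>R iexp (- (s * y)))"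
  have eq: "(\<lambda>s. ?f (0 + (1 / sqrt n) * s)) = ?g"
    using edgeworth_char_scaled[OF n, of _ y ?\<mu> d] by (simp add: x)
  have intg: "integrable lborel ?g"
    by (intro Bochner_Integration.integrable_diff integrable_mult_right integrable_gauss_moment)
  show "integrable lborel ?f"
    using lborel_integrable_real_affine_iff[of "1 / sqrt n" ?f 0] n intg unfolding eq by simp
  have "(CLINT t|lborel. ?f t) = \<bar>1 / sqrt n\<bar> *\<^sub>R (CLINT s|lborel. ?f (0 + (1 / sqrt n) * s))"
    using n by (intro lborel_integral_real_affine) auto
  also have "(CLINT s|lborel. ?f (0 + (1 / sqrt n) * s)) = integral\<^sup>L lborel ?g"
    unfolding eq ..
  also have "integral\<^sup>L lborel ?g = gauss_moment y 0 - (\<i> * d / (2 * sqrt n)) * gauss_moment y 1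
      - (\<i> * ?\<mu> / (6 * sqrt n)) * gauss_moment y 3"
    unfolding gauss_moment_def
    by (subst Bochner_Integration.integral_diff; (intro Bochner_Integration.integrable_diff integrable_mult_right 
        integrable_gauss_moment)?)+ (simp only: integral_mult_right_zero)
  also have "\<dots> = gauss_moment y 0 * (1 - d * y / (2 * sqrt n) + ?\<mu> * (y^3 - 3 * y) / (6 * sqrt n))"
  proof -
    have g1: "gauss_moment y 1 = - \<i> * y * gauss_moment y 0"
      using gauss_moment_Suc[of y 0] by simp
    have g2: "gauss_moment y 2 = (1 - y\<^sup>2) * gauss_moment y 0"
      using gauss_moment_Suc[of y 1] unfolding g1 by (simp add: numeral_2_eq_2 algebra_simps)
    have g3: "gauss_moment y 3 = \<i> * (y ^ 3 - 3 * y) * gauss_moment y 0"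
      using gauss_moment_Suc[of y 2] g1 unfolding g2
      by (simp add: numeral_3_eq_3 numeral_2_eq_2 algebra_simps)
    define w where "w = complex_of_real (sqrt n)"
    have "w \<noteq> 0" using n by (simp add: w_def)
    then show ?thesis
      unfolding g1 g3 by (simp add: field_simps flip: w_def)
  qed
  also have "gauss_moment y 0 = 2 * pi * std_normal_density y"
    by (simp add: gauss_moment_0 std_normal_density_def field_simps flip: of_real_mult)
  finally have "(CLINT t|lborel. ?f t) = 2 * pi * (1 / sqrt n * std_normal_density y *
       (1 - d * y / (2 * sqrt n) + ?\<mu> * (y^3 - 3 * y) / (6 * sqrt n)))"
    using n by (simp add: scaleR_conv_of_real)
  moreover have "expansion F n x d = 1 / sqrt n * std_normal_density y *
       (1 - d * y / (2 * sqrt n) + ?\<mu> * (y^3 - 3 * y) / (6 * sqrt n))"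
    unfolding y_def by (rule expansion_normalised[OF n])
  ultimately show "complex_of_real (expansion F n x d) = 1 / (2 * pi) * (CLINT t|lborel. ?f t)"
    by simp
qed

section \<open>Powers of the characteristic function near the origin\<close>

text \<open>The second order Taylor remainder of \<open>z\<^sup>n\<close>. The natural bound has the factor \<open>m\<^sup>n\<^sup>-\<^sup>2\<close>; multiplying
  by \<open>m\<^sup>2\<close> instead keeps the induction free of truncated exponents.\<close>

lemma power_diff_linearisation:
  fixes a b :: complex
  assumes a: "cmod a \<le> m" and b: "cmod b \<le> m"
  shows "cmod (a ^ n - b ^ n - of_nat n * b ^ (n - 1) * (a - b)) * m\<^sup>2 \<le> (real n)\<^sup>2 * m ^ n * (cmod (a - b))\<^sup>2"
proof (induction n)
  case (Suc n)
  have m: "0 \<le> m" using a norm_ge_zero order_trans by blast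
  let ?D = "\<lambda>n. a ^ n - b ^ n - of_nat n * b ^ (n - 1) * (a - b)"
  have "?D (Suc n) = a * ?D n + of_nat n * b ^ (n - 1) * (a - b)\<^sup>2"
    by (cases n) (simp_all add: algebra_simps power2_eq_square)
  then have "cmod (?D (Suc n)) \<le> cmod a * cmod (?D n) + cmod (of_nat n * b ^ (n - 1) * (a - b)\<^sup>2)"
    by (metis norm_mult norm_triangle_ineq)
  also have "\<dots> \<le> m * cmod (?D n) + real n * cmod b ^ (n - 1) * (cmod (a - b))\<^sup>2"
    using a by (intro add_mono mult_right_mono) (auto simp: norm_mult norm_power)
  finally have "cmod (?D (Suc n)) * m\<^sup>2 \<le> (m * cmod (?D n) + real n * cmod b ^ (n - 1) * (cmod (a - b))\<^sup>2) * m\<^sup>2"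
    by (rule mult_right_mono) simp
  also have "\<dots> = m * (cmod (?D n) * m\<^sup>2) + real n * (cmod b ^ (n - 1) * m\<^sup>2) * (cmod (a - b))\<^sup>2"
    by (simp add: algebra_simps)
  also have "\<dots> \<le> m * ((real n)\<^sup>2 * m ^ n * (cmod (a - b))\<^sup>2) + real n * m ^ Suc n * (cmod (a - b))\<^sup>2"
  proof (intro add_mono mult_left_mono Suc.IH m)
    show "real n * (cmod b ^ (n - 1) * m\<^sup>2) * (cmod (a - b))\<^sup>2 \<le> real n * m ^ Suc n * (cmod (a - b))\<^sup>2"
    proof (cases n)
      case (Suc k)
      have "cmod b ^ k * m\<^sup>2 \<le> m ^ k * m\<^sup>2" using b by (intro mult_right_mono power_mono) auto
      also have "\<dots> = m ^ Suc n" using Suc by (simp add: power2_eq_square)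
      finally show ?thesis using Suc by (intro mult_right_mono mult_left_mono) auto
    qed simp
  qed
  also have "\<dots> = ((real n)\<^sup>2 + real n) * (m ^ Suc n * (cmod (a - b))\<^sup>2)"
    by (simp add: algebra_simps)
  also have "\<dots> \<le> (real (Suc n))\<^sup>2 * (m ^ Suc n * (cmod (a - b))\<^sup>2)"
    using m by (intro mult_right_mono) (auto simp: power2_eq_square algebra_simps)
  finally show ?case by (simp only: mult.assoc)
qed simp

lemma exp_minus_linear_bound:
  fixes u :: real
  assumes "0 \<le> u"
  shows "\<bar>exp (- u) - (1 - u)\<bar> \<le> u\<^sup>2 / 2"
proof -
  define f where "f x = 1 - x + x\<^sup>2 / 2 - exp (- x)" for x :: real
  have "f 0 \<le> f u"
  proof (rule DERIV_nonneg_imp_nondecreasing[OF assms])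
    fix x :: real
    have "(f has_real_derivative (x - 1 + exp (- x))) (at x)"
      unfolding f_def[abs_def] by (auto intro!: derivative_eq_intros)
    moreover have "0 \<le> x - 1 + exp (- x)" using exp_ge_add_one_self[of "-x"] by simp
    ultimately show "\<exists>y. (f has_real_derivative y) (at x) \<and> 0 \<le> y" by blast
  qed
  then show ?thesis using exp_ge_add_one_self[of "-u"] by (simp add: f_def abs_le_iff)
qed

text \<open>The bound that truncating the Taylor series of \<open>exp(itx)\<close> after the cubic term gives for the characteristic
  function, relative to \<open>\<bar>t\<bar>\<^sup>3\<close>. The minimum is what makes it vanish as \<open>t\<close> tends to 0 under a third moment
  alone, and polynomially fast under a higher one.\<close>

definition remainder3 :: "real measure \<Rightarrow> real \<Rightarrow> real" where
  "remainder3 F t = (\<integral>x. min (8 * \<bar>x\<bar> ^ 3) (\<bar>t\<bar> * \<bar>x\<bar> ^ 4) \<partial>F) / 24"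

text \<open>The reciprocal of \<open>b\<close> separates low from high frequencies; \<open>1 \<le> b\<close> ensures that low frequencies satisfy
  \<open>\<bar>t\<bar> \<le> 1\<close>, so that higher powers of \<open>t\<close> are dominated by lower ones.\<close>

locale standardised_law = real_distribution +
  fixes b :: real
  assumes mean: "has_bochner_integral M (\<lambda>x. x) 0"
    and var: "has_bochner_integral M (\<lambda>x. x\<^sup>2) 1"
    and third_int: "integrable M (\<lambda>x. \<bar>x\<bar> ^ 3)"
    and third_le: "(\<integral>x. \<bar>x\<bar> ^ 3 \<partial>M) \<le> b"
    and b_ge_1: "1 \<le> b"
begin

lemma third_moment_bound: "\<bar>third_moment M\<bar> \<le> b"
proof -
  have "\<bar>third_moment M\<bar> \<le> (\<integral>x. \<bar>x ^ 3\<bar> \<partial>M)"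
    unfolding third_moment_def by (rule integral_abs_bound)
  then show ?thesis using third_le by (simp add: power_abs)
qed

lemma integrable_cube: "integrable M (\<lambda>x. x ^ 3)"
  by (rule Bochner_Integration.integrable_bound[OF third_int]) (auto simp: power_abs)

lemma integrable_remainder3: "integrable M (\<lambda>x. min (8 * \<bar>x\<bar> ^ 3) (\<bar>t\<bar> * \<bar>x\<bar> ^ 4))"
  by (rule Bochner_Integration.integrable_bound[OF integrable_mult_right[OF third_int, of 8]])
    (auto simp: abs_mult)

lemma remainder3_nonneg: "0 \<le> remainder3 M t"
  unfolding remainder3_def by (intro divide_nonneg_nonneg integral_nonneg_AE) auto

lemma remainder3_le: "remainder3 M t \<le> b / 3"
proof -
  have "(\<integral>x. min (8 * \<bar>x\<bar> ^ 3) (\<bar>t\<bar> * \<bar>x\<bar> ^ 4) \<partial>M) \<le> (\<integral>x. 8 * \<bar>x\<bar> ^ 3 \<partial>M)"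
    by (intro integral_mono integrable_remainder3 integrable_mult_right third_int) auto
  also have "\<dots> \<le> 8 * b" using third_le by simp
  finally show ?thesis by (simp add: remainder3_def)
qed

lemma prob_UNIV: "measure M UNIV = 1"
  using prob_space by simp

lemma char_third_order:
  "cmod (char M t - (1 - t\<^sup>2 / 2 + third_moment M * (\<i> * t) ^ 3 / 6)) \<le> \<bar>t\<bar> ^ 3 * remainder3 M t"
proof -
  have i: "k \<le> 3 \<Longrightarrow> integrable M (\<lambda>x. x ^ k)" for k
    using integrable_cube mean var
    by (auto simp: le_Suc_eq numeral_3_eq_3 numeral_2_eq_2 has_bochner_integral_iff)
  have s: "(\<Sum>k\<le>3. ((\<i> * t)^k / fact k) * expectation (\<lambda>x. x^k))
      = 1 - t\<^sup>2 / 2 + third_moment M * (\<i> * t) ^ 3 / 6"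
    using mean var
    by (simp add: eval_nat_numeral has_bochner_integral_iff third_moment_def prob_UNIV)
      (simp add: algebra_simps)
  from char_approx2[OF i, of 3 t, unfolded s] show ?thesis
    by (simp add: remainder3_def fact_numeral mult.commute)
qed

lemma char_second_order: "cmod (char M t - (1 - t\<^sup>2 / 2)) \<le> b * \<bar>t\<bar> ^ 3 / 6"
proof -
  have "cmod (char M t - (1 - t\<^sup>2 * 1 / 2)) \<le> t\<^sup>2 / 6 * expectation (\<lambda>x. min (6 * x\<^sup>2) (\<bar>t\<bar> * \<bar>x\<bar> ^ 3))"
    using mean var by (intro char_approx3) (auto simp: has_bochner_integral_iff)
  also have "\<dots> \<le> t\<^sup>2 / 6 * expectation (\<lambda>x. \<bar>t\<bar> * \<bar>x\<bar> ^ 3)"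
  proof (intro mult_left_mono integral_mono)
    show "integrable M (\<lambda>x. min (6 * x\<^sup>2) (\<bar>t\<bar> * \<bar>x\<bar> ^ 3))"
      by (rule Bochner_Integration.integrable_bound[OF integrable_mult_right[OF third_int, of "\<bar>t\<bar>"]])
        auto
  qed (auto intro: third_int)
  also have "\<dots> \<le> t\<^sup>2 / 6 * (\<bar>t\<bar> * b)"
    using third_le by (auto intro!: mult_left_mono)
  also have "\<dots> = b * \<bar>t\<bar> ^ 3 / 6"
    by (simp add: power2_eq_square power3_eq_cube abs_if)
  finally show ?thesis by simp
qed

context
  fixes t :: real
  assumes t: "\<bar>t\<bar> \<le> 1 / b"
begin

lemma t_small: "b * \<bar>t\<bar> \<le> 1" "\<bar>t\<bar> \<le> 1" "t\<^sup>2 \<le> 1" "b * \<bar>t\<bar> ^ 3 \<le> t\<^sup>2" "b * \<bar>t\<bar> ^ 5 \<le> t ^ 4" "t ^ 4 \<le> \<bar>t\<bar> ^ 3"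
proof -
  show 1: "b * \<bar>t\<bar> \<le> 1" using t b_ge_1 by (simp add: field_simps)
  have "1 * \<bar>t\<bar> \<le> b * \<bar>t\<bar>" using b_ge_1 by (intro mult_right_mono) auto
  with 1 show 2: "\<bar>t\<bar> \<le> 1" by linarith
  then show "t\<^sup>2 \<le> 1" by (simp add: abs_square_le_1)
  have "b * \<bar>t\<bar> * t\<^sup>2 \<le> 1 * t\<^sup>2" "b * \<bar>t\<bar> * t^4 \<le> 1 * t^4" "\<bar>t\<bar> * \<bar>t\<bar> ^ 3 \<le> 1 * \<bar>t\<bar> ^ 3"
    using 1 2 by (intro mult_right_mono; simp)+
  moreover have "\<bar>t\<bar> * t\<^sup>2 = \<bar>t\<bar> ^ 3" "\<bar>t\<bar> * t ^ 4 = \<bar>t\<bar> ^ 5" "\<bar>t\<bar> * \<bar>t\<bar> ^ 3 = t ^ 4"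
    by (simp_all add: eval_nat_numeral abs_if)
  ultimately show "b * \<bar>t\<bar> ^ 3 \<le> t\<^sup>2" "b * \<bar>t\<bar> ^ 5 \<le> t ^ 4" "t ^ 4 \<le> \<bar>t\<bar> ^ 3"
    by (simp_all add: mult.assoc)
qed

text \<open>The error of the quadratic approximation to \<open>\<phi>\<close> is at most \<open>b\<bar>t\<bar>\<^sup>3/6 \<le> t\<^sup>2/6\<close> for \<open>\<bar>t\<bar> \<le> 1/b\<close>, which is
  only a third of the quadratic term itself.\<close>

lemma char_gauss_bound: "cmod (char M t) \<le> exp (- t\<^sup>2 / 3)"
proof -
  have "cmod (char M t) \<le> cmod (1 - t\<^sup>2 / 2) + cmod (char M t - (1 - t\<^sup>2 / 2))"
    by (metis add.commute diff_add_cancel norm_triangle_ineq)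
  also have "cmod (1 - t\<^sup>2 / 2) = 1 - t\<^sup>2 / 2"
  proof -
    have "complex_of_real t ^ 2 = of_real (t\<^sup>2)" by simp
    then have "cmod (1 - t\<^sup>2 / 2) = \<bar>1 - t\<^sup>2 / 2\<bar>"
      by (metis norm_of_real of_real_1 of_real_diff of_real_divide of_real_numeral)
    then show ?thesis using t_small(3) by simp
  qed
  also have "cmod (char M t - (1 - t\<^sup>2 / 2)) \<le> t\<^sup>2 / 6"
    using char_second_order[of t] t_small(4) by simp
  also have "1 - t\<^sup>2 / 2 + t\<^sup>2 / 6 = 1 + (- t\<^sup>2 / 3)" by simp
  also have "\<dots> \<le> exp (- t\<^sup>2 / 3)" by (rule exp_ge_add_one_self)
  finally show ?thesis by simp
qed

lemma gauss_taylor: "cmod (complex_of_real (exp (- t\<^sup>2 / 2)) - (1 - t\<^sup>2 / 2)) \<le> t ^ 4 / 8"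
proof -
  have "\<bar>exp (- (t\<^sup>2 / 2)) - (1 - t\<^sup>2 / 2)\<bar> \<le> (t\<^sup>2 / 2)\<^sup>2 / 2"
    by (rule exp_minus_linear_bound) simp
  also have "\<dots> = t ^ 4 / 8" by (simp add: power_divide)
  finally have "cmod (of_real (exp (- (t\<^sup>2 / 2)) - (1 - t\<^sup>2 / 2))) \<le> t ^ 4 / 8" by (simp only: norm_of_real)
  then show ?thesis by simp
qed

lemma char_minus_gauss: "cmod (char M t - complex_of_real (exp (- t\<^sup>2 / 2))) \<le> b * \<bar>t\<bar> ^ 3 / 2"
proof -
  have "cmod (char M t - complex_of_real (exp (- t\<^sup>2 / 2))) \<le>
    cmod (char M t - (1 - t\<^sup>2 / 2)) + cmod (complex_of_real (exp (- t\<^sup>2 / 2)) - (1 - t\<^sup>2 / 2))"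
    using norm_triangle_ineq4[of "char M t - (1 - t\<^sup>2 / 2)" "complex_of_real (exp (- t\<^sup>2 / 2)) - (1 - t\<^sup>2 / 2)"] by simp
  also have "\<dots> \<le> b * \<bar>t\<bar> ^ 3 / 6 + \<bar>t\<bar> ^ 3 / 8"
    using char_second_order[of t] gauss_taylor t_small(6) by linarith
  also have "\<bar>t\<bar> ^ 3 / 8 \<le> b * \<bar>t\<bar> ^ 3 / 8" using b_ge_1 by (simp add: mult_le_cancel_right1)
  finally have "cmod (char M t - complex_of_real (exp (- t\<^sup>2 / 2))) \<le> b * \<bar>t\<bar> ^ 3 / 6 + b * \<bar>t\<bar> ^ 3 / 8" by simp
  moreover have "0 \<le> b * \<bar>t\<bar> ^ 3" using b_ge_1 by simp
  ultimately show ?thesis by linarith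
qed

lemma char_minus_gauss_cubic:
  "cmod (char M t - complex_of_real (exp (- t\<^sup>2 / 2)) - third_moment M * (\<i> * t) ^ 3 / 6) \<le> \<bar>t\<bar> ^ 3 * remainder3 M t + t ^ 4 / 8"
proof -
  have "cmod (char M t - complex_of_real (exp (- t\<^sup>2 / 2)) - third_moment M * (\<i> * t) ^ 3 / 6) \<le>
    cmod (char M t - (1 - (complex_of_real t)\<^sup>2 / 2 + third_moment M * (\<i> * t) ^ 3 / 6)) + cmod (complex_of_real (exp (- t\<^sup>2 / 2)) - (1 - (complex_of_real t)\<^sup>2 / 2))"
    using norm_triangle_ineq4[of "char M t - (1 - (complex_of_real t)\<^sup>2 / 2 + third_moment M * (\<i> * t) ^ 3 / 6)" "complex_of_real (exp (- t\<^sup>2 / 2)) - (1 - (complex_of_real t)\<^sup>2 / 2)"]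
    by (simp add: algebra_simps)
  then show ?thesis using char_third_order[of t] gauss_taylor by simp
qed

text \<open>With \<open>A = \<phi>(t)\<close> and \<open>B = exp(-t\<^sup>2/2)\<close> the difference splits into the linearisation error of \<open>A\<^sup>n\<close> at
  \<open>B\<close>, the error of the cubic approximation to \<open>A - B\<close>, and the replacement of \<open>B\<^sup>n\<^sup>-\<^sup>1\<close> by \<open>B\<^sup>n\<close>. Since
  \<open>\<bar>t\<bar> \<le> 1\<close>, missing factors \<open>B\<close> and \<open>m\<close> cost constants only.\<close>

lemma char_power_edgeworth:
  assumes n: "0 < n"
  defines "m \<equiv> exp (- t\<^sup>2 / 3)"
  defines "B \<equiv> exp (- t\<^sup>2 / 2)"
  defines "c \<equiv> third_moment M * (\<i> * t) ^ 3 / 6"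
  shows "cmod (char M t ^ n - complex_of_real B ^ n * (1 + of_nat n * c))
    \<le> m ^ n * (b\<^sup>2 * (real n)\<^sup>2 * t ^ 6 + n * t ^ 4 + 2 * real n * (\<bar>t\<bar> ^ 3 * remainder3 M t))"
proof -
  let ?A = "char M t" and ?B = "complex_of_real B"
  have m0: "m > 0" and m2: "m\<^sup>2 \<ge> 1 / 3"
  proof -
    have "1 + (- 2 * t\<^sup>2 / 3) \<le> exp (- 2 * t\<^sup>2 / 3)" by (rule exp_ge_add_one_self)
    also have "\<dots> = m\<^sup>2" by (simp add: m_def power2_eq_square flip: exp_add)
    finally show "m\<^sup>2 \<ge> 1 / 3" using t_small(3) by linarith
  qed (simp add: m_def)
  have Bm: "B \<le> m" "0 < B" "B \<le> 1" by (simp_all add: B_def m_def)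
  have B2: "1 / 2 \<le> B" using exp_ge_add_one_self[of "- t\<^sup>2 / 2"] t_small(3) by (simp add: B_def)
  have Bpow: "B ^ (n - 1) \<le> 2 * m ^ n"
  proof -
    have "B ^ (n - 1) * 1 \<le> B ^ (n - 1) * (2 * B)" using B2 Bm by (intro mult_left_mono) auto
    also have "\<dots> = 2 * B ^ n" using n by (cases n) auto
    also have "\<dots> \<le> 2 * m ^ n" using Bm by (simp add: power_mono)
    finally show ?thesis by simp
  qed
  \<comment> \<open>Error of the linearisation at \<open>B\<close>.\<close>
  let ?D1 = "?A ^ n - ?B ^ n - of_nat n * ?B ^ (n - 1) * (?A - ?B)"
  have "cmod ?D1 * m\<^sup>2 \<le> (real n)\<^sup>2 * m ^ n * (cmod (?A - ?B))\<^sup>2"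
    using char_gauss_bound Bm by (intro power_diff_linearisation) (auto simp: m_def)
  also have "\<dots> \<le> (real n)\<^sup>2 * m ^ n * (b * \<bar>t\<bar> ^ 3 / 2)\<^sup>2"
    using char_minus_gauss m0 by (intro mult_left_mono power_mono) (auto simp: B_def)
  finally have "cmod ?D1 * (1 / 3) \<le> (real n)\<^sup>2 * m ^ n * (b * \<bar>t\<bar> ^ 3 / 2)\<^sup>2"
    using mult_left_mono[OF m2 norm_ge_zero, of ?D1] by linarith
  also have "(b * \<bar>t\<bar> ^ 3 / 2)\<^sup>2 = b\<^sup>2 * t ^ 6 / 4"
    by (simp add: power_mult_distrib power_divide flip: power_mult)
  finally have "cmod ?D1 \<le> 3 / 4 * (m ^ n * (b\<^sup>2 * (real n)\<^sup>2 * t ^ 6))"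
    by (simp add: mult_ac)
  also have "\<dots> \<le> m ^ n * (b\<^sup>2 * (real n)\<^sup>2 * t ^ 6)"
    using m0 by (intro mult_left_le_one_le) auto
  finally have D1: "cmod ?D1 \<le> m ^ n * (b\<^sup>2 * (real n)\<^sup>2 * t ^ 6)" .
  \<comment> \<open>Error of the cubic approximation to \<open>A - B\<close>.\<close>
  let ?D2 = "of_nat n * ?B ^ (n - 1) * (?A - ?B - c)"
  have "cmod ?D2 = n * B ^ (n - 1) * cmod (?A - ?B - c)"
    using Bm by (simp add: norm_mult norm_power)
  also have "\<dots> \<le> n * (2 * m ^ n) * (\<bar>t\<bar> ^ 3 * remainder3 M t + t ^ 4 / 8)"
    using char_minus_gauss_cubic Bpow m0 by (intro mult_mono) (auto simp: B_def c_def)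
  finally have D2: "cmod ?D2 \<le> n * (2 * m ^ n) * (\<bar>t\<bar> ^ 3 * remainder3 M t + t ^ 4 / 8)" .
  \<comment> \<open>Error of replacing \<open>B\<^sup>n\<^sup>-\<^sup>1\<close> by \<open>B\<^sup>n\<close> in the cubic term.\<close>
  let ?D3 = "of_nat n * ?B ^ (n - 1) * ((1 - ?B) * c)"
  have c: "cmod c \<le> b * \<bar>t\<bar> ^ 3 / 6"
    using mult_right_mono[OF third_moment_bound, of "\<bar>t\<bar> ^ 3"]
    by (simp add: c_def norm_mult norm_power norm_divide)
  have B1: "1 - B \<le> t\<^sup>2 / 2" using exp_ge_add_one_self[of "- t\<^sup>2 / 2"] by (simp add: B_def)
  have "cmod ?D3 = n * B ^ (n - 1) * ((1 - B) * cmod c)"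
  proof -
    have "cmod (1 - ?B) = 1 - B" using Bm by (metis abs_of_nonneg diff_ge_0_iff_ge norm_of_real of_real_1 of_real_diff)
    then show ?thesis using Bm by (simp add: norm_mult norm_power)
  qed
  also have "\<dots> \<le> n * (2 * m ^ n) * (t\<^sup>2 / 2 * (b * \<bar>t\<bar> ^ 3 / 6))"
    using c Bpow B1 Bm m0 b_ge_1 by (intro mult_mono) auto
  also have "t\<^sup>2 / 2 * (b * \<bar>t\<bar> ^ 3 / 6) = b * \<bar>t\<bar> ^ 5 / 12"
    using power_add[of "\<bar>t\<bar>" 2 3] by simp
  also have "n * (2 * m ^ n) * (b * \<bar>t\<bar> ^ 5 / 12) \<le> n * (2 * m ^ n) * (t ^ 4 / 12)"
    using t_small(5) m0 by (intro mult_left_mono) auto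
  finally have D3: "cmod ?D3 \<le> n * (2 * m ^ n) * (t ^ 4 / 12)" .
  have "?A ^ n - ?B ^ n * (1 + of_nat n * c) = ?D1 + ?D2 + ?D3"
    using n by (cases n) (simp_all add: algebra_simps)
  then have "cmod (?A ^ n - ?B ^ n * (1 + of_nat n * c)) \<le> cmod ?D1 + cmod ?D2 + cmod ?D3"
    by (metis norm_triangle_le order_refl add_mono norm_triangle_ineq)
  also have "\<dots> \<le> m ^ n * (b\<^sup>2 * (real n)\<^sup>2 * t ^ 6) + n * (2 * m ^ n) * (\<bar>t\<bar> ^ 3 * remainder3 M t + t ^ 4 / 8) + n * (2 * m ^ n) * (t ^ 4 / 12)"
    using D1 D2 D3 by linarith
  also have "\<dots> \<le> m ^ n * (b\<^sup>2 * (real n)\<^sup>2 * t ^ 6 + n * t ^ 4 + 2 * real n * (\<bar>t\<bar> ^ 3 * remainder3 M t))"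
  proof -
    have "0 \<le> m ^ n * n * t ^ 4" using m0 by simp
    then show ?thesis by (simp add: algebra_simps)
  qed
  finally show ?thesis .
qed

end
end

section \<open>Comparison of the two integrands\<close>

lemma norm_triangle3:
  fixes x y z :: "'a :: real_normed_vector"
  shows "norm (x + y - z) \<le> norm x + norm y + norm z" "norm (x - y + z) \<le> norm x + norm y + norm z"
  using norm_triangle_ineq4[of "x + y" z] norm_triangle_ineq[of x y]
    norm_triangle_ineq4[of x y] norm_triangle_ineq[of "x - y" z] by linarith+

text \<open>Each monomial is of total order \<open>n\<^sup>-\<^sup>3\<^sup>/\<^sup>2\<close> after integration against the Gaussian factor, except for
  the smoothing term with \<open>g\<close> and the cubic term.\<close>

definition edgeworth_error :: "real measure \<Rightarrow> nat \<Rightarrow> real \<Rightarrow> real \<Rightarrow> real" where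
  "edgeworth_error M n g t = exp (- real n * t\<^sup>2 / 3) *
     (t\<^sup>2 + real n * t ^ 4 + (real n)\<^sup>2 * t ^ 6 + g * \<bar>t\<bar> + real n * (\<bar>t\<bar> ^ 3 * remainder3 M t))"

context standardised_law begin

text \<open>Three replacements are made in turn: \<open>w \<kappa>\<close> by its linear part \<open>L\<close>, \<open>\<phi>\<^sup>n\<close> by its Edgeworth
  approximation, and the product of the two approximations by \<open>edgeworth_char\<close>.\<close>

lemma low_frequency_bound:
  fixes \<kappa> :: complex
  assumes t: "\<bar>t\<bar> \<le> 1 / b" "t \<noteq> 0" and n: "0 < n" and d: "0 < d" "d \<le> D" and g: "0 \<le> g"
    and \<kappa>: "cmod \<kappa> \<le> 1" "cmod (\<kappa> - 1) \<le> g * \<bar>t\<bar>"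
  shows "cmod (interval_kernel d t * (char M t ^ n * \<kappa>) - edgeworth_char (third_moment M) n d t)
     \<le> 10 * (1 + D)\<^sup>2 * b\<^sup>2 * edgeworth_error M n g t"
proof -
  define m where "m = exp (- t\<^sup>2 / 3)"
  define B where "B = exp (- t\<^sup>2 / 2)"
  define c where "c = third_moment M * (\<i> * t) ^ 3 / 6"
  define L where "L = 1 - \<i> * t * d / 2"
  define r where "r = \<bar>t\<bar> ^ 3 * remainder3 M t"
  define C where "C = 10 * (1 + D)\<^sup>2 * b\<^sup>2"
  let ?w = "interval_kernel d t" and ?A = "char M t"
  have m0: "0 < m" by (simp add: m_def)
  have r0: "0 \<le> r" unfolding r_def using remainder3_nonneg by simp
  have D0: "0 < D" using d by simp
  have mn: "m ^ n = exp (- real n * t\<^sup>2 / 3)" by (simp add: m_def flip: exp_of_nat_mult)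
  have Bn: "B ^ n = exp (- real n * t\<^sup>2 / 2)" by (simp add: B_def flip: exp_of_nat_mult)
  have Bm: "B ^ n \<le> m ^ n" "0 < B" by (auto intro!: power_mono simp: B_def m_def)
  have A: "cmod ?A ^ n \<le> m ^ n" using char_gauss_bound[OF t(1)] by (intro power_mono) (auto simp: m_def)
  have td: "\<bar>t\<bar> * d \<le> D" using t_small(2)[OF t(1)] d mult_mono[of "\<bar>t\<bar>" 1 d D] by simp
  have L: "cmod L \<le> 1 + D"
  proof -
    have "cmod L \<le> cmod 1 + cmod (\<i> * t * d / 2)" unfolding L_def by (rule norm_triangle_ineq4)
    also have "\<dots> = 1 + \<bar>t\<bar> * d / 2" using d by (simp add: norm_mult norm_divide)
    also have "\<dots> \<le> 1 + D" using td D0 by simp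
    finally show ?thesis .
  qed
  have 1: "cmod ((?w * \<kappa> - L) * ?A ^ n) \<le> m ^ n * (D\<^sup>2 * t\<^sup>2 / 6 + (1 + D) * (g * \<bar>t\<bar>))"
  proof -
    have "?w * \<kappa> - L = (?w - L) * \<kappa> + L * (\<kappa> - 1)" by (simp add: algebra_simps)
    then have "cmod (?w * \<kappa> - L) \<le> cmod (?w - L) * cmod \<kappa> + cmod L * cmod (\<kappa> - 1)"
      by (metis norm_mult norm_triangle_ineq)
    also have "\<dots> \<le> (t * d)\<^sup>2 / 6 * 1 + (1 + D) * (g * \<bar>t\<bar>)"
      using interval_kernel_approx[OF d(1) t(2)] \<kappa> L D0 by (intro add_mono mult_mono) (auto simp: L_def)
    also have "(t * d)\<^sup>2 / 6 * 1 \<le> D\<^sup>2 * t\<^sup>2 / 6"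
      using d power_mono[of d D 2] by (simp add: power_mult_distrib mult.commute mult_right_mono)
    finally have "cmod (?w * \<kappa> - L) \<le> D\<^sup>2 * t\<^sup>2 / 6 + (1 + D) * (g * \<bar>t\<bar>)" by simp
    then have "cmod (?w * \<kappa> - L) * cmod ?A ^ n \<le> (D\<^sup>2 * t\<^sup>2 / 6 + (1 + D) * (g * \<bar>t\<bar>)) * m ^ n"
      using A D0 g by (intro mult_mono) auto
    then show ?thesis by (simp add: norm_mult norm_power mult.commute)
  qed
  have 2: "cmod (L * (?A ^ n - complex_of_real B ^ n * (1 + of_nat n * c)))
      \<le> (1 + D) * (m ^ n * (b\<^sup>2 * (real n)\<^sup>2 * t ^ 6 + n * t ^ 4 + 2 * real n * r))"
    unfolding norm_mult using L char_power_edgeworth[OF t(1) n] D0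
    by (intro mult_mono) (auto simp: m_def B_def c_def r_def)
  have 3: "cmod (complex_of_real B ^ n * (\<i> * t * d / 2 * (of_nat n * c))) \<le> m ^ n * (n * (D * b * t ^ 4))"
  proof -
    have "cmod (\<i> * t * d / 2 * (of_nat n * c)) = real n * d * \<bar>third_moment M\<bar> * t ^ 4 / 12"
      using d by (simp add: c_def norm_mult norm_power norm_divide eval_nat_numeral abs_mult_self_eq)
    also have "\<dots> \<le> real n * D * b * t ^ 4 / 12"
      using d third_moment_bound b_ge_1 D0 by (intro divide_right_mono mult_mono) auto
    also have "\<dots> \<le> n * (D * b * t ^ 4)" using D0 b_ge_1 by simp
    finally have "B ^ n * cmod (\<i> * t * d / 2 * (of_nat n * c)) \<le> m ^ n * (n * (D * b * t ^ 4))"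
      using Bm m0 by (intro mult_mono) auto
    then show ?thesis using Bm by (simp add: norm_mult norm_power)
  qed
  have E: "edgeworth_char (third_moment M) n d t = complex_of_real B ^ n * (L + of_nat n * c)"
    unfolding edgeworth_char_def Bn[symmetric] L_def c_def by simp
  have "?w * (?A ^ n * \<kappa>) - edgeworth_char (third_moment M) n d t =
      (?w * \<kappa> - L) * ?A ^ n + L * (?A ^ n - complex_of_real B ^ n * (1 + of_nat n * c))
      - complex_of_real B ^ n * (\<i> * t * d / 2 * (of_nat n * c))"
    unfolding E by (simp add: L_def algebra_simps)
  then have "cmod (?w * (?A ^ n * \<kappa>) - edgeworth_char (third_moment M) n d t) \<le>
      cmod ((?w * \<kappa> - L) * ?A ^ n) + cmod (L * (?A ^ n - complex_of_real B ^ n * (1 + of_nat n * c)))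
      + cmod (complex_of_real B ^ n * (\<i> * t * d / 2 * (of_nat n * c)))"
    by (simp only: norm_triangle3)
  also have "\<dots> \<le> m ^ n * (D\<^sup>2 * t\<^sup>2 / 6 + (1 + D) * (g * \<bar>t\<bar>))
      + (1 + D) * (m ^ n * (b\<^sup>2 * (real n)\<^sup>2 * t ^ 6 + n * t ^ 4 + 2 * real n * r))
      + m ^ n * (n * (D * b * t ^ 4))"
    using 1 2 3 by linarith
  also have "\<dots> = m ^ n * (D\<^sup>2 / 6 * t\<^sup>2 + ((1 + D) + D * b) * (n * t ^ 4)
      + ((1 + D) * b\<^sup>2) * ((real n)\<^sup>2 * t ^ 6) + (1 + D) * (g * \<bar>t\<bar>) + (2 * (1 + D)) * (n * r))"
    by (simp add: algebra_simps)
  \<comment> \<open>\<open>C\<close> is a common upper bound for the five coefficients.\<close>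
  also have "\<dots> \<le> m ^ n * (C * t\<^sup>2 + C * (n * t ^ 4)
      + C * ((real n)\<^sup>2 * t ^ 6) + C * (g * \<bar>t\<bar>) + C * (n * r))"
  proof -
    have b: "1 \<le> b\<^sup>2" "b \<le> b\<^sup>2" using b_ge_1 by (auto simp: power2_eq_square mult_le_cancel_right1 intro: order_trans)
    have D1: "1 + D \<le> (1 + D)\<^sup>2" "D\<^sup>2 \<le> (1 + D)\<^sup>2" using D0 by (auto simp: power2_eq_square algebra_simps)
    have K: "(1 + D)\<^sup>2 * 1 \<le> (1 + D)\<^sup>2 * b\<^sup>2" "(1 + D) * b\<^sup>2 \<le> (1 + D)\<^sup>2 * b\<^sup>2" "D * b \<le> (1 + D)\<^sup>2 * b\<^sup>2"
      using b D1 D0 b_ge_1 by (auto intro!: mult_mono mult_right_mono)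
    define Q where "Q = (1 + D)\<^sup>2 * b\<^sup>2"
    have "D\<^sup>2 / 6 \<le> 10 * Q" "(1 + D) + D * b \<le> 10 * Q" "(1 + D) * b\<^sup>2 \<le> 10 * Q" "1 + D \<le> 10 * Q" "2 * (1 + D) \<le> 10 * Q"
    proof -
      have Q: "(1 + D)\<^sup>2 \<le> Q" "(1 + D) * b\<^sup>2 \<le> Q" "D * b \<le> Q" using K by (simp_all add: Q_def)
      have "1 + D \<le> Q" "D\<^sup>2 \<le> Q" using Q(1) D1 by (auto intro: order_trans)
      then show "D\<^sup>2 / 6 \<le> 10 * Q" "(1 + D) + D * b \<le> 10 * Q" "(1 + D) * b\<^sup>2 \<le> 10 * Q" "1 + D \<le> 10 * Q"
        using Q D0 zero_le_power2[of D] by linarith+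
      have "2 + 2 * D \<le> 10 * Q" using \<open>1 + D \<le> Q\<close> D0 by linarith
      then show "2 * (1 + D) \<le> 10 * Q" by (simp only: distrib_left mult_1_right)
    qed
    then have "D\<^sup>2 / 6 \<le> C" "(1 + D) + D * b \<le> C"
      "(1 + D) * b\<^sup>2 \<le> C" "1 + D \<le> C" "2 * (1 + D) \<le> C"
      by (simp_all only: C_def Q_def mult.assoc)
    then show ?thesis using m0 g r0 by (intro mult_left_mono add_mono mult_right_mono) auto
  qed
  also have "\<dots> = C * edgeworth_error M n g t"
    unfolding edgeworth_error_def mn[symmetric] r_def[symmetric] by (simp add: algebra_simps)
  finally show ?thesis unfolding C_def .
qed

text \<open>Here the two integrands are bounded separately. The approximation is Gaussian small, and since
  \<open>b\<bar>t\<bar> \<ge> 1\<close> its polynomial factor is dominated by monomials that are already part of \<open>edgeworth_error\<close>. In the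
  other integrand the kernels contribute \<open>4/(d g t\<^sup>2)\<close>, which is integrable away from the origin.\<close>

lemma high_frequency_bound:
  fixes \<kappa> :: complex
  assumes t: "1 / b < \<bar>t\<bar>" and n: "0 < n" and d: "0 < d" "d \<le> D" and g: "0 < g"
    and \<kappa>: "cmod \<kappa> \<le> 2 / (g * \<bar>t\<bar>)" and \<rho>: "cmod (char M t) \<le> \<rho>"
  shows "cmod (interval_kernel d t * (char M t ^ n * \<kappa>) - edgeworth_char (third_moment M) n d t)
     \<le> 10 * (1 + D)\<^sup>2 * b\<^sup>2 * edgeworth_error M n g t + 8 * b\<^sup>2 * (\<rho> ^ n / (d * g)) * inverse (1 + t\<^sup>2)"
proof -
  have t0: "t \<noteq> 0" using t b_ge_1 by auto
  have D0: "0 < D" using d by simp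
  have bt: "1 \<le> b * \<bar>t\<bar>" using t b_ge_1 by (simp add: field_simps)
  then have "1 * 1 \<le> (b * \<bar>t\<bar>) * (b * \<bar>t\<bar>)" by (intro mult_mono) auto
  then have bt2: "1 \<le> b\<^sup>2 * t\<^sup>2" by (simp add: power2_eq_square mult_ac)
  have b2: "1 \<le> b\<^sup>2" using b_ge_1 by simp
  have tail: "inverse (t\<^sup>2) \<le> 2 * b\<^sup>2 * inverse (1 + t\<^sup>2)"
  proof -
    have "t\<^sup>2 \<le> b\<^sup>2 * t\<^sup>2" using b2 by (simp add: mult_le_cancel_right1)
    then have "1 + t\<^sup>2 \<le> 2 * b\<^sup>2 * t\<^sup>2" using bt2 by linarith
    then show ?thesis using t0 by (simp add: field_simps add_pos_nonneg)
  qed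
  have "cmod (interval_kernel d t * (char M t ^ n * \<kappa>)) \<le> 2 / (d * \<bar>t\<bar>) * (\<rho> ^ n * (2 / (g * \<bar>t\<bar>)))"
    unfolding norm_mult norm_power using interval_kernel_bound[OF d(1) t0] \<rho> \<kappa> d g order_trans[OF norm_ge_zero \<rho>]
    by (intro mult_mono power_mono) auto
  also have "\<dots> = 4 * (\<rho> ^ n / (d * g)) * inverse (t\<^sup>2)"
    using t0 d g by (simp add: field_simps power2_eq_square abs_mult_self_eq)
  also have "\<dots> \<le> 4 * (\<rho> ^ n / (d * g)) * (2 * b\<^sup>2 * inverse (1 + t\<^sup>2))"
    using tail d g order_trans[OF norm_ge_zero \<rho>] by (intro mult_left_mono) auto
  finally have 1: "cmod (interval_kernel d t * (char M t ^ n * \<kappa>)) \<le> 8 * b\<^sup>2 * (\<rho> ^ n / (d * g)) * inverse (1 + t\<^sup>2)"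
    by (simp add: mult_ac)
  have "cmod (edgeworth_char (third_moment M) n d t) \<le> exp (- real n * t\<^sup>2 / 3) * (10 * (1 + D)\<^sup>2 * b\<^sup>2 * (t\<^sup>2 + real n * t ^ 4))"
  proof -
    have "cmod (1 - \<i> * t * d / 2 + complex_of_real (real n * third_moment M) * (\<i> * t) ^ 3 / 6)
        \<le> cmod 1 + cmod (\<i> * t * d / 2) + cmod (complex_of_real (real n * third_moment M) * (\<i> * t) ^ 3 / 6)"
      by (rule norm_triangle3)
    also have "\<dots> = 1 + \<bar>t\<bar> * d / 2 + real n * \<bar>third_moment M\<bar> * \<bar>t\<bar> ^ 3 / 6"
      using d by (simp add: norm_mult norm_divide norm_power)
    also have "\<dots> \<le> b\<^sup>2 * t\<^sup>2 + D * (b\<^sup>2 * t\<^sup>2) + real n * (b\<^sup>2 * t ^ 4)"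
    proof (intro add_mono bt2)
      have t1: "\<bar>t\<bar> \<le> b\<^sup>2 * t\<^sup>2"
      proof -
        have "\<bar>t\<bar> * 1 \<le> \<bar>t\<bar> * (b * (b * \<bar>t\<bar>))"
          using bt b_ge_1 mult_mono[of 1 b 1 "b * \<bar>t\<bar>"] by (intro mult_left_mono) auto
        then show ?thesis by (simp add: power2_eq_square mult_ac)
      qed
      have "\<bar>t\<bar> * d \<le> (b\<^sup>2 * t\<^sup>2) * D" using t1 d by (intro mult_mono) auto
      moreover have "0 \<le> D * (b\<^sup>2 * t\<^sup>2)" using D0 by simp
      ultimately show "\<bar>t\<bar> * d / 2 \<le> D * (b\<^sup>2 * t\<^sup>2)" by (simp add: mult.commute)
      have "\<bar>third_moment M\<bar> * \<bar>t\<bar> ^ 3 \<le> b * \<bar>t\<bar> ^ 3 * (b * \<bar>t\<bar>)"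
      proof -
        have "\<bar>third_moment M\<bar> * \<bar>t\<bar> ^ 3 \<le> b * \<bar>t\<bar> ^ 3"
          by (intro mult_right_mono third_moment_bound) simp
        also have "b * \<bar>t\<bar> ^ 3 \<le> b * \<bar>t\<bar> ^ 3 * (b * \<bar>t\<bar>)"
          using mult_left_mono[OF bt, of "b * \<bar>t\<bar> ^ 3"] b_ge_1 by simp
        finally show ?thesis .
      qed
      also have "\<dots> = b\<^sup>2 * t ^ 4" by (simp add: eval_nat_numeral abs_if)
      finally have "real n * (\<bar>third_moment M\<bar> * \<bar>t\<bar> ^ 3) \<le> real n * (b\<^sup>2 * t ^ 4)"
        by (intro mult_left_mono) auto
      moreover have "0 \<le> real n * (\<bar>third_moment M\<bar> * \<bar>t\<bar> ^ 3)" by simp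
      ultimately show "real n * \<bar>third_moment M\<bar> * \<bar>t\<bar> ^ 3 / 6 \<le> real n * (b\<^sup>2 * t ^ 4)"
        unfolding mult.assoc by linarith
    qed
    also have "\<dots> = ((1 + D) * b\<^sup>2) * t\<^sup>2 + b\<^sup>2 * (real n * t ^ 4)" by (simp add: algebra_simps)
    also have "\<dots> \<le> (10 * (1 + D)\<^sup>2 * b\<^sup>2) * t\<^sup>2 + (10 * (1 + D)\<^sup>2 * b\<^sup>2) * (real n * t ^ 4)"
    proof (rule add_mono; rule mult_right_mono)
      have "1 + D \<le> 10 * (1 + D)\<^sup>2" "1 \<le> 10 * (1 + D)\<^sup>2" using D0 by (auto simp: power2_eq_square algebra_simps)
      from mult_right_mono[OF this(1), of "b\<^sup>2"] mult_right_mono[OF this(2), of "b\<^sup>2"]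
      show "(1 + D) * b\<^sup>2 \<le> 10 * (1 + D)\<^sup>2 * b\<^sup>2" "b\<^sup>2 \<le> 10 * (1 + D)\<^sup>2 * b\<^sup>2" by auto
    qed auto
    finally have "cmod (1 - \<i> * t * d / 2 + complex_of_real (real n * third_moment M) * (\<i> * t) ^ 3 / 6)
      \<le> 10 * (1 + D)\<^sup>2 * b\<^sup>2 * (t\<^sup>2 + real n * t ^ 4)" by (simp only: distrib_left)
    moreover have "exp (- real n * t\<^sup>2 / 2) \<le> exp (- real n * t\<^sup>2 / 3)"
      by simp
    ultimately have "exp (- real n * t\<^sup>2 / 2) * cmod (1 - \<i> * t * d / 2 + complex_of_real (real n * third_moment M) * (\<i> * t) ^ 3 / 6)
       \<le> exp (- real n * t\<^sup>2 / 3) * (10 * (1 + D)\<^sup>2 * b\<^sup>2 * (t\<^sup>2 + real n * t ^ 4))"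
      by (intro mult_mono) auto
    then show ?thesis unfolding edgeworth_char_def norm_mult norm_of_real abs_exp_cancel .
  qed
  also have "\<dots> \<le> 10 * (1 + D)\<^sup>2 * b\<^sup>2 * edgeworth_error M n g t"
  proof -
    have "t\<^sup>2 + real n * t ^ 4 \<le> t\<^sup>2 + real n * t ^ 4 + (real n)\<^sup>2 * t ^ 6 + g * \<bar>t\<bar> + real n * (\<bar>t\<bar> ^ 3 * remainder3 M t)"
      using g remainder3_nonneg[of t] by (simp add: add_nonneg_nonneg)
    then have "10 * (1 + D)\<^sup>2 * b\<^sup>2 * (exp (- real n * t\<^sup>2 / 3) * (t\<^sup>2 + real n * t ^ 4)) \<le> 10 * (1 + D)\<^sup>2 * b\<^sup>2 * edgeworth_error M n g t"
      unfolding edgeworth_error_def by (intro mult_left_mono) auto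
    then show ?thesis by (simp add: mult_ac)
  qed
  finally show ?thesis
    using 1 norm_triangle_ineq4[of "interval_kernel d t * (char M t ^ n * \<kappa>)" "edgeworth_char (third_moment M) n d t"]
    by linarith
qed

end

section \<open>Integrating the error\<close>

lemma integrable_gauss_abs_power: "integrable lborel (\<lambda>s::real. exp (- s\<^sup>2 / 3) * \<bar>s\<bar> ^ k)"
proof -
  define \<sigma> :: real where "\<sigma> = sqrt (3/2)"
  have s: "0 < \<sigma>" "2 * \<sigma>\<^sup>2 = 3" by (simp_all add: \<sigma>_def)
  have "integrable lborel (\<lambda>s. sqrt (2 * pi * \<sigma>\<^sup>2) * (normal_density 0 \<sigma> s * \<bar>s - 0\<bar> ^ k))"
    by (intro integrable_mult_right integrable_normal_moment_abs s)
  then show ?thesis using s by (simp add: normal_density_def)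
qed

definition gauss_poly_integral :: real where
  "gauss_poly_integral = (LINT s|lborel. exp (- s\<^sup>2 / 3) * (s\<^sup>2 + s ^ 4 + s ^ 6 + \<bar>s\<bar>))"

lemma integrable_gauss_poly: "integrable lborel (\<lambda>s::real. exp (- s\<^sup>2 / 3) * (s\<^sup>2 + s ^ 4 + s ^ 6 + \<bar>s\<bar>))"
  using integrable_gauss_abs_power[of 1] integrable_gauss_abs_power[of 2] integrable_gauss_abs_power[of 4] integrable_gauss_abs_power[of 6]
  by (simp add: distrib_left)

lemma gauss_poly_integral_nonneg: "0 \<le> gauss_poly_integral"
  unfolding gauss_poly_integral_def by (intro integral_nonneg_AE) auto

text \<open>The only part of the error whose rate is governed by more than the bound \<open>b\<close>: it tends to 0 for each fixed law,
  but not uniformly over all laws with the same third moment bound.\<close>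

definition cubic_error :: "real measure \<Rightarrow> nat \<Rightarrow> real" where
  "cubic_error M n = (LINT s|lborel. exp (- s\<^sup>2 / 3) * \<bar>s\<bar> ^ 3 * remainder3 M (s / sqrt n))"

context standardised_law begin

lemma remainder3_measurable [measurable]: "remainder3 M \<in> borel_measurable borel"
  unfolding remainder3_def[abs_def] by measurable

lemma integrable_cubic_error: "integrable lborel (\<lambda>s. exp (- s\<^sup>2 / 3) * \<bar>s\<bar> ^ 3 * remainder3 M (s / sqrt n))"
proof (rule Bochner_Integration.integrable_bound)
  show "integrable lborel (\<lambda>s. exp (- s\<^sup>2 / 3) * \<bar>s\<bar> ^ 3 * (b / 3))"
    by (intro integrable_mult_left integrable_gauss_abs_power)
  show "AE s in lborel. norm (exp (- s\<^sup>2 / 3) * \<bar>s\<bar> ^ 3 * remainder3 M (s / sqrt n)) \<le> norm (exp (- s\<^sup>2 / 3) * \<bar>s\<bar> ^ 3 * (b / 3))"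
    using remainder3_nonneg remainder3_le b_ge_1
    by (intro AE_I2) (simp add: abs_mult mult_left_mono)
qed measurable

lemma cubic_error_nonneg: "0 \<le> cubic_error M n"
  unfolding cubic_error_def using remainder3_nonneg by (intro integral_nonneg_AE) auto

text \<open>Substitute \<open>t = s / sqrt n\<close>.\<close>

lemma
  assumes n: "0 < n" and g: "0 \<le> g"
  shows integrable_edgeworth_error: "integrable lborel (edgeworth_error M n g)"
    and integral_edgeworth_error: "n * integral\<^sup>L lborel (edgeworth_error M n g) \<le> gauss_poly_integral * (1 / sqrt n + g) + cubic_error M n"
proof -
  define w where "w = sqrt n"
  have w: "0 < w" "real n = w\<^sup>2" using n by (simp_all add: w_def)
  let ?G = "\<lambda>s::real. exp (- s\<^sup>2 / 3) * (s\<^sup>2 + s ^ 4 + s ^ 6)" and ?S = "\<lambda>s::real. exp (- s\<^sup>2 / 3) * \<bar>s\<bar>"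
    and ?P = "\<lambda>s. exp (- s\<^sup>2 / 3) * \<bar>s\<bar> ^ 3 * remainder3 M (s / w)"
  let ?g = "\<lambda>s. ?G s / w\<^sup>2 + g / w * ?S s + ?P s / w"
  have eq: "(\<lambda>s. edgeworth_error M n g (0 + (1 / w) * s)) = ?g"
  proof
    fix s
    have "s\<^sup>2 / w\<^sup>2 + w\<^sup>2 * (s ^ 4 / w ^ 4) + (w\<^sup>2)\<^sup>2 * (s ^ 6 / w ^ 6) = (s\<^sup>2 + s ^ 4 + s ^ 6) / w\<^sup>2"
      "w\<^sup>2 * (\<bar>s\<bar> ^ 3 / w ^ 3) = \<bar>s\<bar> ^ 3 / w"
      using w(1) by (simp_all add: field_simps eval_nat_numeral)
    then have "exp (- s\<^sup>2 / 3) * ((s\<^sup>2 / w\<^sup>2 + w\<^sup>2 * (s ^ 4 / w ^ 4) + (w\<^sup>2)\<^sup>2 * (s ^ 6 / w ^ 6)) + g * (\<bar>s\<bar> / w)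
          + (w\<^sup>2 * (\<bar>s\<bar> ^ 3 / w ^ 3)) * remainder3 M (s / w)) = ?g s"
      by (simp only:) (simp add: algebra_simps)
    moreover have "w\<^sup>2 * (s / w)\<^sup>2 = s\<^sup>2" using w(1) by (simp add: power_divide)
    ultimately show "edgeworth_error M n g (0 + (1 / w) * s) = ?g s"
      unfolding edgeworth_error_def w(2) using w(1) by (simp add: power_divide abs_divide mult.assoc)
  qed
  have iG: "integrable lborel ?G" "integrable lborel ?S"
    using integrable_gauss_abs_power[of 1] integrable_gauss_abs_power[of 2] integrable_gauss_abs_power[of 4] integrable_gauss_abs_power[of 6]
    by (simp_all add: distrib_left)
  have iP: "integrable lborel ?P" using integrable_cubic_error[of n] by (simp add: w_def)
  have ig: "integrable lborel ?g"
    using iG iP by (intro Bochner_Integration.integrable_add integrable_divide_zero integrable_mult_right)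
  show "integrable lborel (edgeworth_error M n g)"
    using lborel_integrable_real_affine_iff[of "1 / w" "edgeworth_error M n g" 0] w ig unfolding eq by simp
  have "integral\<^sup>L lborel (edgeworth_error M n g) = \<bar>1 / w\<bar> *\<^sub>R (LINT s|lborel. edgeworth_error M n g (0 + (1 / w) * s))"
    using w by (intro lborel_integral_real_affine) auto
  also have "\<dots> = 1 / w * integral\<^sup>L lborel ?g" unfolding eq using w by simp
  also have "integral\<^sup>L lborel ?g = integral\<^sup>L lborel ?G / w\<^sup>2 + g / w * integral\<^sup>L lborel ?S + integral\<^sup>L lborel ?P / w"
  proof -
    have "integral\<^sup>L lborel ?g = (LINT s|lborel. ?G s / w\<^sup>2 + g / w * ?S s) + (LINT s|lborel. ?P s / w)"
      using iG iP by (intro Bochner_Integration.integral_add Bochner_Integration.integrable_add integrable_divide_zero integrable_mult_right)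
    also have "(LINT s|lborel. ?G s / w\<^sup>2 + g / w * ?S s) = (LINT s|lborel. ?G s / w\<^sup>2) + (LINT s|lborel. g / w * ?S s)"
      using iG by (intro Bochner_Integration.integral_add integrable_divide_zero integrable_mult_right)
    finally show ?thesis by (simp only: integral_divide_zero integral_mult_right_zero)
  qed
  finally have "n * integral\<^sup>L lborel (edgeworth_error M n g) = integral\<^sup>L lborel ?G / w + g * integral\<^sup>L lborel ?S + cubic_error M n"
    using w(1) unfolding w(2) by (simp add: cubic_error_def w_def[symmetric] field_simps power2_eq_square)
  also have "\<dots> \<le> gauss_poly_integral / w + g * gauss_poly_integral + cubic_error M n"
  proof -
    have "integral\<^sup>L lborel ?G \<le> gauss_poly_integral" "integral\<^sup>L lborel ?S \<le> gauss_poly_integral"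
      unfolding gauss_poly_integral_def
      by (intro integral_mono iG integrable_gauss_poly; simp)+
    then show ?thesis using w g by (intro add_mono divide_right_mono mult_left_mono) auto
  qed
  also have "\<dots> = gauss_poly_integral * (1 / sqrt n + g) + cubic_error M n"
    by (simp add: w_def algebra_simps)
  finally show "n * integral\<^sup>L lborel (edgeworth_error M n g) \<le> gauss_poly_integral * (1 / sqrt n + g) + cubic_error M n" .
qed

end

lemma
  shows integrable_cauchy: "integrable lborel (\<lambda>t::real. inverse (1 + t\<^sup>2))"
    and integral_cauchy: "(LINT t|lborel. inverse (1 + t\<^sup>2)) = pi"
  using integrable_inverse_1_plus_square LBINT_inverse_1_plus_square
  by (simp_all add: set_integrable_def interval_lebesgue_integral_def set_lebesgue_integral_def)

definition smoothed_sum_law :: "real measure \<Rightarrow> nat \<Rightarrow> real \<Rightarrow> real \<Rightarrow> real measure" where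
  "smoothed_sum_law F n u v = smoothed_law (sum_law F n) (uniform_law u v)"

context standardised_law begin

text \<open>The absolute value of \<open>exp(-itx)\<close> is 1, so integrating the pointwise bounds controls the
  difference for all \<open>x\<close> at once. The conditions on \<open>u\<close> and \<open>v\<close> admit perturbations of
  either sign, \<open>[0, g]\<close> and \<open>[-g, 0]\<close>.\<close>

lemma smoothed_sum_expansion:
  assumes \<rho>: "\<And>t. 1 / b < \<bar>t\<bar> \<Longrightarrow> cmod (char M t) \<le> \<rho>"
    and n: "0 < n" and d: "0 < d" "d \<le> D"
    and uv: "u < v" "\<bar>u\<bar> \<le> v - u" "\<bar>v\<bar> \<le> v - u"
  shows "n * \<bar>measure (smoothed_sum_law M n u v) {x<..x+d} / d - expansion M n x d\<bar>
     \<le> 10 * (1 + D)\<^sup>2 * b\<^sup>2 * (gauss_poly_integral * (1 / sqrt n + (v - u)) + cubic_error M n)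
        + 8 * b\<^sup>2 * pi * (n * \<rho> ^ n / (d * (v - u)))"
proof -
  define g where "g = v - u"
  have g: "0 < g" using uv by (simp add: g_def)
  let ?K = "uniform_law u v" and ?S = "sum_law M n" and ?H = "smoothed_sum_law M n u v"
  let ?C = "10 * (1 + D)\<^sup>2 * b\<^sup>2"
  interpret K: real_distribution ?K by (rule real_distribution_uniform_law[OF uv(1)])
  interpret S: real_distribution ?S by (rule real_distribution_sum_law)
  interpret H: real_distribution ?H unfolding smoothed_sum_law_def
    by (rule real_distribution_smoothed_law) (rule S.real_distribution_axioms K.real_distribution_axioms)+
  have charH: "char ?H t = char M t ^ n * char ?K t" for t
    unfolding smoothed_sum_law_def
    by (simp add: char_smoothed_law[OF S.real_distribution_axioms K.real_distribution_axioms] char_sum_law)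
  have atoms: "measure ?H {a} = 0" for a
    unfolding smoothed_sum_law_def
    by (rule smoothed_law_singleton[OF S.real_distribution_axioms K.real_distribution_axioms uniform_law_singleton[OF uv(1)]])
  let ?f = "\<lambda>t. iexp (- (t * x)) * interval_kernel d t * char ?H t"
  let ?e = "\<lambda>t. iexp (- (t * x)) * edgeworth_char (third_moment M) n d t"
  let ?B = "\<lambda>t. ?C * edgeworth_error M n g t + 8 * b\<^sup>2 * (\<rho> ^ n / (d * g)) * inverse (1 + t\<^sup>2)"
  have \<rho>0: "0 \<le> \<rho>" using order_trans[OF norm_ge_zero \<rho>[of "1 / b + 1"]] b_ge_1 by simp
  have bound: "cmod (?f t - ?e t) \<le> ?B t" if "t \<noteq> 0" for t
  proof -
    have "?f t - ?e t = iexp (- (t * x)) * (interval_kernel d t * (char M t ^ n * char ?K t) - edgeworth_char (third_moment M) n d t)"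
      by (simp add: charH algebra_simps)
    then have eq: "cmod (?f t - ?e t) = cmod (interval_kernel d t * (char M t ^ n * char ?K t) - edgeworth_char (third_moment M) n d t)"
      by (simp only: norm_mult norm_exp_i_times mult_1)
    show ?thesis
    proof (cases "\<bar>t\<bar> \<le> 1 / b")
      case True
      have "cmod (?f t - ?e t) \<le> ?C * edgeworth_error M n g t"
        unfolding eq using g uv
        by (intro low_frequency_bound True that n d K.cmod_char_le_1 char_uniform_law_near_1) (auto simp: g_def)
      moreover have "0 \<le> 8 * b\<^sup>2 * (\<rho> ^ n / (d * g)) * inverse (1 + t\<^sup>2)"
        using d g \<rho>0 by (intro mult_nonneg_nonneg divide_nonneg_nonneg) (auto simp: add_nonneg_nonneg)
      ultimately show ?thesis by linarith
    next
      case False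
      then show ?thesis
        unfolding eq using char_uniform_law_bound[OF uv(1) that] 
        by (intro high_frequency_bound n d g \<rho>) (auto simp: g_def)
    qed
  qed
  have intB: "integrable lborel ?B"
    using n g by (intro Bochner_Integration.integrable_add integrable_mult_right integrable_edgeworth_error integrable_cauchy) auto
  have inte: "integrable lborel ?e" by (rule integrable_edgeworth_char[OF n])
  have AE0: "AE t in lborel. t \<noteq> (0::real)" by (rule AE_lborel_singleton)
  have intfe: "integrable lborel (\<lambda>t. ?f t - ?e t)"
  proof (rule Bochner_Integration.integrable_bound[OF intB])
    show "AE t in lborel. norm (?f t - ?e t) \<le> norm (?B t)"
      using AE0 by (rule eventually_mono) (use bound in \<open>unfold real_norm_def, blast intro: order_trans[OF _ abs_ge_self]\<close>)
    show "(\<lambda>t. ?f t - ?e t) \<in> borel_measurable lborel"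
      unfolding edgeworth_char_def by measurable
  qed
  have intf: "integrable lborel ?f"
    using Bochner_Integration.integrable_add[OF intfe inte] by simp
  have "complex_of_real (measure ?H {x<..x+d} / d - expansion M n x d)
     = 1 / (2 * pi) * (CLINT t|lborel. ?f t - ?e t)"
    unfolding of_real_diff H.interval_prob_fourier[OF d(1) atoms intf] expansion_fourier[OF n]
    by (simp only: Bochner_Integration.integral_diff[OF intf inte] right_diff_distrib)
  then have "cmod (complex_of_real (measure ?H {x<..x+d} / d - expansion M n x d)) = cmod (1 / (2 * pi) * (CLINT t|lborel. ?f t - ?e t))"
    by (rule arg_cong)
  also have "\<dots> = 1 / (2 * pi) * cmod (CLINT t|lborel. ?f t - ?e t)"
    by (simp only: norm_mult norm_of_real) simp
  finally have "\<bar>measure ?H {x<..x+d} / d - expansion M n x d\<bar> = 1 / (2 * pi) * cmod (CLINT t|lborel. ?f t - ?e t)"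
    by (simp only: norm_of_real)
  also have "\<dots> \<le> 1 * cmod (CLINT t|lborel. ?f t - ?e t)"
    using pi_gt3 by (intro mult_right_mono) auto
  also have "\<dots> \<le> 1 * (LINT t|lborel. ?B t)"
  proof (intro mult_left_mono)
    have "cmod (CLINT t|lborel. ?f t - ?e t) \<le> (LINT t|lborel. cmod (?f t - ?e t))"
      by (rule integral_norm_bound)
    also have "\<dots> \<le> (LINT t|lborel. ?B t)"
      by (intro integral_mono_AE integrable_norm intfe intB eventually_mono[OF AE0] bound)
    finally show "cmod (CLINT t|lborel. ?f t - ?e t) \<le> (LINT t|lborel. ?B t)" .
  qed simp
  also have "(LINT t|lborel. ?B t) = ?C * integral\<^sup>L lborel (edgeworth_error M n g) + 8 * b\<^sup>2 * (\<rho> ^ n / (d * g)) * pi"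
    using n g integrable_edgeworth_error integrable_cauchy
    by (subst Bochner_Integration.integral_add) (auto simp: integral_cauchy)
  finally have "n * \<bar>measure ?H {x<..x+d} / d - expansion M n x d\<bar>
      \<le> n * (?C * integral\<^sup>L lborel (edgeworth_error M n g) + 8 * b\<^sup>2 * (\<rho> ^ n / (d * g)) * pi)"
    by (intro mult_left_mono) auto
  also have "\<dots> = ?C * (n * integral\<^sup>L lborel (edgeworth_error M n g)) + 8 * b\<^sup>2 * pi * (n * \<rho> ^ n / (d * g))"
    by (simp add: algebra_simps)
  also have "\<dots> \<le> ?C * (gauss_poly_integral * (1 / sqrt n + g) + cubic_error M n) + 8 * b\<^sup>2 * pi * (n * \<rho> ^ n / (d * g))"
    using n g by (intro add_right_mono mult_left_mono integral_edgeworth_error) auto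
  finally show ?thesis unfolding g_def .
qed

end

section \<open>From smoothed to original probabilities\<close>

lemma std_normal_density_moment_bounds:
  "std_normal_density y \<le> 1" "std_normal_density y * \<bar>y\<bar> \<le> 1" "std_normal_density y * \<bar>y\<bar> ^ 3 \<le> 4"
proof -
  define u where "u = y\<^sup>2 / 2"
  have u: "0 \<le> u" "y\<^sup>2 = 2 * u" by (simp_all add: u_def)
  have e: "1 + u + u\<^sup>2 / 2 \<le> exp u" by (rule exp_lower_Taylor_quadratic[OF u(1)])
  have "1 / sqrt (2 * pi) \<le> 1" using pi_gt3 by (simp add: real_le_rsqrt)
  then have d: "std_normal_density y \<le> exp (- u)"
    using mult_right_mono[of "1 / sqrt (2 * pi)" 1 "exp (- u)"] by (simp add: std_normal_density_def u_def)
  have *: "std_normal_density y * z \<le> c" if "0 \<le> z" "z \<le> c * exp u" for z c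
  proof -
    have "std_normal_density y * z \<le> exp (- u) * (c * exp u)"
      using d that by (intro mult_mono) auto
    then show ?thesis by (simp add: exp_minus field_simps)
  qed
  have "0 \<le> (\<bar>y\<bar> - 1)\<^sup>2" by simp
  then have y1: "2 * \<bar>y\<bar> \<le> 1 + 2 * u"
    unfolding u(2)[symmetric] by (simp add: power2_eq_square algebra_simps)
  have y3: "2 * \<bar>y\<bar> ^ 3 \<le> 2 * u + 4 * u\<^sup>2"
  proof -
    have "2 * \<bar>y\<bar> ^ 3 = 2 * \<bar>y\<bar> * y\<^sup>2" by (simp add: power3_eq_cube power2_eq_square)
    also have "\<dots> \<le> (1 + 2 * u) * y\<^sup>2" using y1 by (rule mult_right_mono) simp
    also have "\<dots> = 2 * u + 4 * u\<^sup>2" unfolding u(2) by (simp add: power2_eq_square algebra_simps)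
    finally show ?thesis .
  qed
  have u2: "0 \<le> u\<^sup>2" by simp
  show "std_normal_density y \<le> 1" using *[of 1 1] e u u2 by simp
  have "\<bar>y\<bar> \<le> 1 * exp u" using y1 e u2 u(1) by linarith
  then show "std_normal_density y * \<bar>y\<bar> \<le> 1" by (intro *) auto
  have "\<bar>y\<bar> ^ 3 \<le> 4 * exp u" using y3 e u2 u(1) by linarith
  then show "std_normal_density y * \<bar>y\<bar> ^ 3 \<le> 4" by (intro *) auto
qed

text \<open>The sandwich changes the length of the interval while keeping its left endpoint, so only the
  dependence on the length needs to be controlled.\<close>

lemma expansion_lipschitz:
  assumes n: "0 < n"
  shows "\<bar>expansion F n x d - expansion F n x d'\<bar> \<le> \<bar>d - d'\<bar>"
proof -
  define y where "y = x / sqrt n"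
  have s1: "1 \<le> sqrt n" "1 \<le> real n" using n by simp_all
  have "expansion F n x d - expansion F n x d' = (d' - d) * (std_normal_density y * y / (2 * n))"
  proof -
    define w where "w = sqrt n"
    have w: "real n = w * w" "w > 0" using n by (simp_all add: w_def)
    show ?thesis
      unfolding expansion_normalised[OF n] unfolding y_def[symmetric] unfolding w_def[symmetric] using w(2)
      by (simp add: w(1) field_simps)
  qed
  then have "\<bar>expansion F n x d - expansion F n x d'\<bar> = \<bar>d - d'\<bar> * (std_normal_density y * \<bar>y\<bar> / (2 * n))"
    by (simp add: abs_mult abs_minus_commute)
  also have "\<dots> \<le> \<bar>d - d'\<bar> * 1"
    using std_normal_density_moment_bounds(2)[of y] s1 
    by (intro mult_left_mono) (auto simp: divide_le_eq)
  finally show ?thesis by simp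
qed

lemma (in standardised_law) expansion_bound:
  assumes n: "0 < n" and d: "0 \<le> d" "d \<le> D"
  shows "\<bar>expansion M n x d\<bar> \<le> 3 * b + D"
proof -
  define y where "y = x / sqrt n"
  let ?\<phi> = "std_normal_density y"
  have s1: "1 \<le> sqrt n" using n by simp
  have "\<bar>1 - d * y / (2 * sqrt n) + third_moment M * (y^3 - 3 * y) / (6 * sqrt n)\<bar>
      \<le> 1 + d * \<bar>y\<bar> / (2 * sqrt n) + \<bar>third_moment M\<bar> * (\<bar>y\<bar>^3 + 3 * \<bar>y\<bar>) / (6 * sqrt n)"
  proof -
    have "\<bar>y^3 - 3 * y\<bar> \<le> \<bar>y\<bar>^3 + 3 * \<bar>y\<bar>"
      using abs_triangle_ineq4[of "y^3" "3 * y"] by (simp add: power_abs abs_mult)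
    then have "\<bar>third_moment M * (y^3 - 3 * y) / (6 * sqrt n)\<bar> \<le> \<bar>third_moment M\<bar> * (\<bar>y\<bar>^3 + 3 * \<bar>y\<bar>) / (6 * sqrt n)"
      by (simp add: abs_mult divide_right_mono mult_left_mono)
    moreover have "\<bar>d * y / (2 * sqrt n)\<bar> = d * \<bar>y\<bar> / (2 * sqrt n)" using d by (simp add: abs_mult)
    ultimately show ?thesis by linarith
  qed
  also have "\<dots> \<le> 1 + D * \<bar>y\<bar> / 2 + b * (\<bar>y\<bar>^3 + 3 * \<bar>y\<bar>) / 6"
    using third_moment_bound b_ge_1 d s1 by (intro add_mono frac_le mult_mono) auto
  finally have "?\<phi> * \<bar>1 - d * y / (2 * sqrt n) + third_moment M * (y^3 - 3 * y) / (6 * sqrt n)\<bar>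
      \<le> ?\<phi> * (1 + D * \<bar>y\<bar> / 2 + b * (\<bar>y\<bar>^3 + 3 * \<bar>y\<bar>) / 6)"
    by (intro mult_left_mono) auto
  also have "\<dots> = ?\<phi> + D / 2 * (?\<phi> * \<bar>y\<bar>) + b / 6 * (?\<phi> * \<bar>y\<bar>^3 + 3 * (?\<phi> * \<bar>y\<bar>))"
    by (simp add: algebra_simps)
  also have "\<dots> \<le> 1 + D / 2 * 1 + b / 6 * (4 + 3 * 1)"
    using d b_ge_1 by (intro add_mono mult_left_mono std_normal_density_moment_bounds) auto
  also have "\<dots> \<le> 3 * b + D" using d b_ge_1 by simp
  finally have A: "?\<phi> * \<bar>1 - d * y / (2 * sqrt n) + third_moment M * (y^3 - 3 * y) / (6 * sqrt n)\<bar> \<le> 3 * b + D" .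
  have "\<bar>expansion M n x d\<bar> = 1 / sqrt n * (?\<phi> * \<bar>1 - d * y / (2 * sqrt n) + third_moment M * (y^3 - 3 * y) / (6 * sqrt n)\<bar>)"
    unfolding expansion_normalised[OF n] y_def[symmetric] by (simp add: abs_mult)
  also have "\<dots> \<le> 1 * (3 * b + D)"
    using s1 b_ge_1 d by (intro mult_mono A) auto
  finally show ?thesis by simp
qed

lemma quadratic_geometric_bounded:
  fixes \<theta> :: real
  assumes "0 < \<theta>" "\<theta> < 1"
  obtains A where "0 \<le> A" "\<And>n. (real n)\<^sup>2 * \<theta> ^ n \<le> A"
proof -
  have "(\<lambda>n. real n * sqrt \<theta> ^ n) \<longlonglongrightarrow> 0"
    using assms by (intro powser_times_n_limit_0) auto
  then have "Bseq (\<lambda>n. real n * sqrt \<theta> ^ n)"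
    by (intro convergent_imp_Bseq convergentI)
  then obtain K where K: "0 < K" "\<And>n. norm (real n * sqrt \<theta> ^ n) \<le> K" by (auto elim: BseqE)
  have "(real n)\<^sup>2 * \<theta> ^ n \<le> K\<^sup>2" for n
  proof -
    have "(real n * sqrt \<theta> ^ n)\<^sup>2 \<le> K\<^sup>2"
      using K(2)[of n] assms by (intro power_mono) auto
    moreover have "(sqrt \<theta> ^ n)\<^sup>2 = \<theta> ^ n"
      using assms by (simp flip: power_mult add: power_mult[of _ 2] mult.commute[of n 2])
    ultimately show ?thesis by (simp add: power_mult_distrib)
  qed
  then show thesis using that[of "K\<^sup>2"] by auto
qed

context real_distribution begin

text \<open>A positive perturbation of at most \<open>g\<close> keeps a point of \<open>[x, x + d)\<close> to the right of \<open>x\<close>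
  and moves it past \<open>x + d\<close> by at most \<open>g\<close>. The next lemma is the converse, with a negative perturbation; choosing
  the signs in this way avoids shifting \<open>x\<close>.\<close>

lemma sum_prob_le_smoothed:
  assumes "0 < g"
  shows "sum_prob M n {x..<x + d} \<le> measure (smoothed_sum_law M n 0 g) {x<..x + (d + g)}"
proof -
  let ?K = "uniform_law 0 g"
  have K: "real_distribution ?K" by (rule real_distribution_uniform_law[OF assms(1)])
  have "measure (sum_law M n) {x..<x + d} \<le> measure (smoothed_sum_law M n 0 g) {x<..x + (d + g)}"
    unfolding smoothed_sum_law_def
  proof (rule measure_le_smoothed_law[OF real_distribution_sum_law K])
    show "AE u in ?K. \<forall>s\<in>{x..<x + d}. s + u \<in> {x<..x + (d + g)}"
      using AE_uniform_law[OF assms(1)] by eventually_elim auto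
  qed auto
  then show ?thesis by (simp add: sum_prob_eq_sum_law)
qed

lemma smoothed_le_sum_prob:
  assumes "0 < g"
  shows "measure (smoothed_sum_law M n (- g) 0) {x<..x + (d - g)} \<le> sum_prob M n {x..<x + d}"
proof -
  let ?K = "uniform_law (- g) 0"
  have g: "- g < 0" using assms by simp
  have K: "real_distribution ?K" by (rule real_distribution_uniform_law[OF g])
  have "measure (smoothed_sum_law M n (- g) 0) {x<..x + (d - g)} \<le> measure (sum_law M n) {x..<x + d}"
    unfolding smoothed_sum_law_def
  proof (rule smoothed_law_le_measure[OF real_distribution_sum_law K])
    show "AE u in ?K. \<forall>s. s + u \<in> {x<..x + (d - g)} \<longrightarrow> s \<in> {x..<x + d}"
      using AE_uniform_law[OF g] by eventually_elim auto
  qed auto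
  then show ?thesis by (simp add: sum_prob_eq_sum_law)
qed

end

text \<open>The perturbation has length \<open>g = \<Delta> \<theta>\<^sup>n\<close>: then \<open>\<theta>\<^sup>4\<^sup>n / (\<Delta> g) \<le> \<theta>\<^sup>n\<close>, so that high frequencies are
  harmless, and the relative change of the interval length is \<open>\<theta>\<^sup>n\<close>, which is negligible even after multiplication
  by \<open>n\<close>. The constant is chosen before the law, as uniformity over a class requires.\<close>

lemma edgeworth_remainder_bound:
  fixes b \<theta> D :: real
  assumes b: "1 \<le> b" and \<theta>: "0 < \<theta>" "\<theta> < 1" and D: "0 < D"
  shows "\<exists>C\<ge>0. \<forall>F n x \<Delta>. standardised_law F b \<longrightarrow> (\<forall>t. 1 / b < \<bar>t\<bar> \<longrightarrow> cmod (char F t) \<le> \<theta> ^ 4) \<longrightarrow>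
     0 < n \<longrightarrow> \<theta> ^ n \<le> \<Delta> \<longrightarrow> \<Delta> \<le> D \<longrightarrow> \<bar>remainder F n x \<Delta>\<bar> \<le> C * (1 / sqrt n + cubic_error F n)"
proof -
  obtain A where A: "0 \<le> A" "\<And>n. (real n)\<^sup>2 * \<theta> ^ n \<le> A"
    using quadratic_geometric_bounded[OF \<theta>] by blast
  let ?G = gauss_poly_integral
  define K where "K = 10 * (1 + 2 * D)\<^sup>2 * b\<^sup>2"
  define L where "L = 8 * b\<^sup>2 * pi / (1 - \<theta>)"
  define E where "E = 3 * b + 2 * D"
  define C where "C = 2 * (K * (?G * (1 + D * A) + 1) + L * A) + E * A + D * A"
  have K0: "0 \<le> K" and L0: "0 \<le> L" and E0: "0 \<le> E" using b D \<theta> by (auto simp: K_def L_def E_def)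
  note G0 = gauss_poly_integral_nonneg
  have C0: "0 \<le> C" unfolding C_def using K0 L0 E0 G0 A(1) D by (intro add_nonneg_nonneg mult_nonneg_nonneg) auto
  have main: "\<bar>remainder F n x \<Delta>\<bar> \<le> C * (1 / sqrt n + cubic_error F n)"
    if F: "standardised_law F b" and char: "\<And>t. 1 / b < \<bar>t\<bar> \<Longrightarrow> cmod (char F t) \<le> \<theta> ^ 4"
      and n: "0 < n" and \<Delta>: "\<theta> ^ n \<le> \<Delta>" "\<Delta> \<le> D" for F n x \<Delta>
  proof -
    interpret standardised_law F b by (rule F)
    define e where "e = \<theta> ^ n"
    define g where "g = \<Delta> * e"
    define \<epsilon> where "\<epsilon> = 1 / sqrt n"
    define \<psi> where "\<psi> = cubic_error F n"
    have \<psi>0: "0 \<le> \<psi>" unfolding \<psi>_def by (rule cubic_error_nonneg)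
    have e: "0 < e" "e \<le> \<theta>" "e < 1"
      using \<theta> n power_decreasing[of 1 n \<theta>] by (auto simp: e_def)
    have \<Delta>0: "0 < \<Delta>" using e \<Delta> by (simp add: e_def)
    have g: "0 < g" "g < \<Delta>" "g \<le> D * e" using e \<Delta>0 \<Delta> by (simp_all add: g_def)
    have \<epsilon>: "0 < \<epsilon>" using n by (simp add: \<epsilon>_def)
    \<comment> \<open>The bound on \<open>n\<^sup>2 \<theta>\<^sup>n\<close> leaves a spare factor \<open>1/n \<le> n\<^sup>-\<^sup>1\<^sup>/\<^sup>2\<close>.\<close>
    have ne: "n * e \<le> A * \<epsilon>"
    proof -
      have "n * e \<le> A / n" using A(2)[of n] n by (simp add: e_def field_simps power2_eq_square)
      also have "\<dots> \<le> A / sqrt n"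
      proof (rule divide_left_mono)
        have "sqrt n * 1 \<le> sqrt n * sqrt n" using n by (intro mult_left_mono) auto
        then show "sqrt n \<le> n" by simp
      qed (use A(1) n in auto)
      finally show ?thesis by (simp add: \<epsilon>_def)
    qed
    have "1 * e \<le> n * e" using n e by (intro mult_right_mono) auto
    with ne have e\<epsilon>: "e \<le> A * \<epsilon>" by simp
    have smooth: "n * \<bar>measure (smoothed_sum_law F n u v) {x<..x+d} / d - expansion F n x d\<bar>
        \<le> (K * (?G * (1 + D * A) + 1) + L * A) * (\<epsilon> + \<psi>)"
      if d: "\<Delta> * (1 - e) \<le> d" "d \<le> 2 * D" and uv: "u = 0 \<and> v = g \<or> u = - g \<and> v = 0" for d u v
    proof -
      have "0 < \<Delta> * (1 - e)" using \<Delta>0 e by simp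
      then have d0: "0 < d" using d by linarith
      have vu: "v - u = g" using uv by auto
      have "n * \<bar>measure (smoothed_sum_law F n u v) {x<..x+d} / d - expansion F n x d\<bar>
          \<le> 10 * (1 + 2 * D)\<^sup>2 * b\<^sup>2 * (?G * (1 / sqrt n + (v - u)) + cubic_error F n)
            + 8 * b\<^sup>2 * pi * (n * (\<theta> ^ 4) ^ n / (d * (v - u)))"
        by (rule smoothed_sum_expansion) (use char n d d0 uv g in auto)
      also have "\<dots> = K * (?G * (\<epsilon> + g) + \<psi>) + 8 * b\<^sup>2 * pi * (n * e ^ 4 / (d * g))"
        unfolding vu by (simp add: K_def \<epsilon>_def \<psi>_def e_def mult.commute flip: power_mult)
      also have "\<dots> \<le> K * (?G * (1 + D * A) * \<epsilon> + \<psi>) + L * A * \<epsilon>"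
      proof (rule add_mono)
        have "\<epsilon> + g \<le> (1 + D * A) * \<epsilon>"
        proof -
          have "D * e \<le> D * (A * \<epsilon>)" using D e\<epsilon> by (intro mult_left_mono) auto
          then have "g \<le> D * (A * \<epsilon>)" using g(3) by linarith
          then show ?thesis by (simp add: algebra_simps)
        qed
        then have "?G * (\<epsilon> + g) \<le> ?G * ((1 + D * A) * \<epsilon>)" using G0 by (rule mult_left_mono)
        then show "K * (?G * (\<epsilon> + g) + \<psi>) \<le> K * (?G * (1 + D * A) * \<epsilon> + \<psi>)"
          using K0 by (intro mult_left_mono add_right_mono) (auto simp: mult.assoc)
        have "(e * (1 - \<theta>)) * (e * e) \<le> d * g"
        proof (rule mult_mono)
          show "e * (1 - \<theta>) \<le> d" using d(1) mult_mono[of e \<Delta> "1 - \<theta>" "1 - e"] e \<theta> \<Delta> \<Delta>0 by (simp add: e_def)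
          show "e * e \<le> g" using \<Delta> e by (simp add: g_def e_def mult_right_mono)
        qed (use d0 e in auto)
        then have "n * e ^ 4 / (d * g) \<le> n * e ^ 4 / ((e * (1 - \<theta>)) * (e * e))"
          using e \<theta> d0 g by (intro divide_left_mono mult_pos_pos) auto
        also have "\<dots> = n * e / (1 - \<theta>)" using e \<theta> by (simp add: eval_nat_numeral field_simps)
        also have "\<dots> \<le> A * \<epsilon> / (1 - \<theta>)" using ne \<theta> by (intro divide_right_mono) auto
        finally have "8 * b\<^sup>2 * pi * (n * e ^ 4 / (d * g)) \<le> 8 * b\<^sup>2 * pi * (A * \<epsilon> / (1 - \<theta>))"
          by (intro mult_left_mono) auto
        then show "8 * b\<^sup>2 * pi * (n * e ^ 4 / (d * g)) \<le> L * A * \<epsilon>" by (simp add: L_def)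
      qed
      also have "\<dots> = (K * (?G * (1 + D * A)) + L * A) * \<epsilon> + K * \<psi>" by (simp add: algebra_simps)
      also have "\<dots> \<le> (K * (?G * (1 + D * A)) + L * A) * \<epsilon> + K * \<psi> + (K * \<epsilon> + (K * (?G * (1 + D * A)) + L * A) * \<psi>)"
        using K0 L0 G0 A(1) D \<epsilon> \<psi>0 by simp
      also have "\<dots> = (K * (?G * (1 + D * A) + 1) + L * A) * (\<epsilon> + \<psi>)" by (simp add: algebra_simps)
      finally show ?thesis .
    qed
    let ?P = "sum_prob F n {x..<x + \<Delta>}" and ?S = "(K * (?G * (1 + D * A) + 1) + L * A) * (\<epsilon> + \<psi>)"
    have S0: "0 \<le> ?S" using K0 L0 G0 A(1) D \<epsilon> \<psi>0 by (intro mult_nonneg_nonneg add_nonneg_nonneg) auto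
    have le: "n * (e * E) \<le> E * A * (\<epsilon> + \<psi>)" "n * g \<le> D * A * (\<epsilon> + \<psi>)"
    proof -
      have "n * e \<le> A * (\<epsilon> + \<psi>)" using ne A(1) \<psi>0 by (simp add: algebra_simps add_increasing2)
      then have "E * (n * e) \<le> E * (A * (\<epsilon> + \<psi>))" "D * (n * e) \<le> D * (A * (\<epsilon> + \<psi>))"
        using E0 D by (auto intro: mult_left_mono)
      moreover have "n * g \<le> D * (n * e)" using mult_left_mono[OF g(3), of n] by (simp add: mult_ac)
      ultimately show "n * (e * E) \<le> E * A * (\<epsilon> + \<psi>)" "n * g \<le> D * A * (\<epsilon> + \<psi>)"
        by (simp_all only: mult_ac)
    qed
    have upper: "remainder F n x \<Delta> \<le> 2 * ?S + n * (e * E) + n * g"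
    proof -
      define d where "d = \<Delta> + g"
      define I where "I = measure (smoothed_sum_law F n 0 g) {x<..x+d} / d"
      have d: "0 < d" "d = (1 + e) * \<Delta>" "d \<le> 2 * D" using \<Delta>0 g \<Delta> by (auto simp: d_def g_def algebra_simps)
      have "?P \<le> d * I" using sum_prob_le_smoothed[OF g(1), of n x \<Delta>] d(1)
        unfolding I_def d_def[symmetric] by simp
      then have "1 / \<Delta> * ?P \<le> (1 + e) * I" using \<Delta>0 unfolding d(2) by (simp add: field_simps)
      \<comment> \<open>\<open>d\<close> and \<open>\<Delta>\<close> differ by the factor \<open>1 + e\<close>, which is split off before comparing the expansions.\<close>
      then have "1 / \<Delta> * ?P - expansion F n x \<Delta> \<le> (1 + e) * (I - expansion F n x d) + e * expansion F n x d + (expansion F n x d - expansion F n x \<Delta>)"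
        by (simp add: algebra_simps)
      also have "\<dots> \<le> 2 * \<bar>I - expansion F n x d\<bar> + e * E + g"
      proof (intro add_mono)
        have "(1 + e) * (I - expansion F n x d) \<le> \<bar>(1 + e) * (I - expansion F n x d)\<bar>" by (rule abs_ge_self)
        also have "\<dots> \<le> 2 * \<bar>I - expansion F n x d\<bar>" using e by (simp add: abs_mult mult_right_mono)
        finally show "(1 + e) * (I - expansion F n x d) \<le> 2 * \<bar>I - expansion F n x d\<bar>" .
        show "e * expansion F n x d \<le> e * E"
          using expansion_bound[OF n, of d "2 * D" x] d e unfolding E_def by (intro mult_left_mono) auto
        show "expansion F n x d - expansion F n x \<Delta> \<le> g"
          using expansion_lipschitz[OF n, of F x d \<Delta>] g by (simp add: d_def)
      qed
      finally have "remainder F n x \<Delta> \<le> n * (2 * \<bar>I - expansion F n x d\<bar> + e * E + g)"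
        unfolding remainder_def by (intro mult_left_mono) auto
      also have "\<dots> = 2 * (n * \<bar>I - expansion F n x d\<bar>) + n * (e * E) + n * g" by (simp add: algebra_simps)
      also have "n * \<bar>I - expansion F n x d\<bar> \<le> ?S"
        unfolding I_def using d \<Delta>0 e by (intro smooth) auto
      finally show ?thesis by simp
    qed
    have lower: "- remainder F n x \<Delta> \<le> 2 * ?S + n * (e * E) + n * g"
    proof -
      define d where "d = \<Delta> - g"
      define I where "I = measure (smoothed_sum_law F n (- g) 0) {x<..x+d} / d"
      have d: "0 < d" "d = (1 - e) * \<Delta>" "d \<le> 2 * D" using \<Delta>0 g \<Delta> D by (auto simp: d_def g_def algebra_simps)
      have "d * I \<le> ?P" using smoothed_le_sum_prob[OF g(1), of n x \<Delta>] d(1)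
        unfolding I_def d_def[symmetric] by simp
      then have "(1 - e) * I \<le> 1 / \<Delta> * ?P" using \<Delta>0 unfolding d(2) by (simp add: field_simps)
      then have "expansion F n x \<Delta> - 1 / \<Delta> * ?P \<le> (1 - e) * (expansion F n x d - I) + e * expansion F n x d + (expansion F n x \<Delta> - expansion F n x d)"
        by (simp add: algebra_simps)
      also have "\<dots> \<le> 2 * \<bar>I - expansion F n x d\<bar> + e * E + g"
      proof (intro add_mono)
        have "(1 - e) * (expansion F n x d - I) \<le> \<bar>(1 - e) * (expansion F n x d - I)\<bar>" by (rule abs_ge_self)
        also have "\<dots> \<le> 2 * \<bar>I - expansion F n x d\<bar>" using e by (simp add: abs_mult abs_minus_commute mult_right_mono)
        finally show "(1 - e) * (expansion F n x d - I) \<le> 2 * \<bar>I - expansion F n x d\<bar>" .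
        show "e * expansion F n x d \<le> e * E"
          using expansion_bound[OF n, of d "2 * D" x] d e unfolding E_def by (intro mult_left_mono) auto
        show "expansion F n x \<Delta> - expansion F n x d \<le> g"
          using expansion_lipschitz[OF n, of F x \<Delta> d] g by (simp add: d_def)
      qed
      finally have "n * (expansion F n x \<Delta> - 1 / \<Delta> * ?P) \<le> n * (2 * \<bar>I - expansion F n x d\<bar> + e * E + g)"
        by (intro mult_left_mono) auto
      also have "\<dots> = 2 * (n * \<bar>I - expansion F n x d\<bar>) + n * (e * E) + n * g" by (simp add: algebra_simps)
      also have "n * \<bar>I - expansion F n x d\<bar> \<le> ?S"
        unfolding I_def using d \<Delta>0 e by (intro smooth) (auto simp: mult.commute)
      finally show ?thesis by (simp add: remainder_def algebra_simps)
    qed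
    have "\<bar>remainder F n x \<Delta>\<bar> \<le> 2 * ?S + n * (e * E) + n * g" using upper lower by linarith
    also have "\<dots> \<le> 2 * ?S + E * A * (\<epsilon> + \<psi>) + D * A * (\<epsilon> + \<psi>)" using le by linarith
    also have "\<dots> = C * (\<epsilon> + \<psi>)" by (simp add: C_def algebra_simps)
    finally show ?thesis by (simp add: \<epsilon>_def \<psi>_def)
  qed
  show ?thesis using C0 main by blast
qed

section \<open>Classes with a moment of order between 3 and 4\<close>

lemma moment_classD:
  assumes "F \<in> moment_class r B"
  shows "real_distribution F" "has_bochner_integral F (\<lambda>x. x) 0" "has_bochner_integral F (\<lambda>x. x\<^sup>2) 1"
    "(\<integral>\<^sup>+ x. ennreal (\<bar>x\<bar> powr r) \<partial>F) < B"
  using assms by (simp_all add: moment_class_def)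

lemma integrable_abs_moment:
  assumes "F \<in> moment_class r B"
  shows "integrable F (\<lambda>x. \<bar>x\<bar> powr r)"
proof -
  interpret real_distribution F using moment_classD[OF assms] by simp
  have "(\<integral>\<^sup>+ x. ennreal (norm (\<bar>x\<bar> powr r)) \<partial>F) < \<infinity>"
    using moment_classD(4)[OF assms] by (simp add: less_top[symmetric] order.strict_implies_not_eq) (metis not_less_iff_gr_or_eq top.not_eq_extremum)
  then show ?thesis by (intro integrableI_bounded) auto
qed

text \<open>Young's inequality for \<open>\<bar>x\<bar>\<^sup>r\<close> and 1. Taking expectations, \<open>E\<bar>X\<bar>\<^sup>3\<close> is bounded by a convex
  combination of \<open>E\<bar>X\<bar>\<^sup>r\<close> and 1, hence by any common upper bound of the two.\<close>

lemma cube_le_powr: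
  fixes x r :: real
  assumes r: "3 < r"
  shows "\<bar>x\<bar> ^ 3 \<le> 3 / r * \<bar>x\<bar> powr r + (1 - 3 / r)"
proof (cases "x = 0")
  case False
  have "(\<bar>x\<bar> powr r) powr (3 / r) * 1 powr (1 - 3 / r) \<le> 3 / r * \<bar>x\<bar> powr r + (1 - 3 / r) * 1"
    using r False by (intro Youngs_inequality_0) auto
  then show ?thesis using r False by (simp add: powr_powr)
qed (use r in simp)

context
  fixes F :: "real measure" and r b \<rho> :: real
  assumes r: "3 < r" "r \<le> 4" and b: "1 < b" and F: "F \<in> moment_char_class r b \<rho>"
begin

lemma F_moment: "F \<in> moment_class r (ennreal b)"
  using F by (simp add: moment_char_class_def)

interpretation real_distribution F by (rule moment_classD[OF F_moment])

lemma abs_moment_le: "(\<integral>x. \<bar>x\<bar> powr r \<partial>F) \<le> b"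
proof -
  have "ennreal (\<integral>x. \<bar>x\<bar> powr r \<partial>F) = (\<integral>\<^sup>+ x. ennreal (\<bar>x\<bar> powr r) \<partial>F)"
    by (rule nn_integral_eq_integral[symmetric, OF integrable_abs_moment[OF F_moment]]) auto
  also have "\<dots> \<le> ennreal b" using moment_classD(4)[OF F_moment] by simp
  finally show ?thesis using b by (simp add: ennreal_le_iff)
qed

lemma integrable_third_abs_moment: "integrable F (\<lambda>x. \<bar>x\<bar> ^ 3)"
proof (rule Bochner_Integration.integrable_bound)
  show "integrable F (\<lambda>x. 3 / r * \<bar>x\<bar> powr r + (1 - 3 / r))"
    using integrable_abs_moment[OF F_moment] by simp
  show "AE x in F. norm (\<bar>x\<bar> ^ 3) \<le> norm (3 / r * \<bar>x\<bar> powr r + (1 - 3 / r))"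
    by (intro AE_I2) (use cube_le_powr[OF r(1)] in \<open>auto intro: order_trans[OF _ abs_ge_self]\<close>)
qed auto

lemma standardised_moment_char_class: "standardised_law F b"
proof -
  have "(\<integral>x. \<bar>x\<bar> ^ 3 \<partial>F) \<le> (\<integral>x. 3 / r * \<bar>x\<bar> powr r + (1 - 3 / r) \<partial>F)"
    using integrable_abs_moment[OF F_moment] integrable_third_abs_moment cube_le_powr[OF r(1)]
    by (intro integral_mono) auto
  also have "\<dots> = 3 / r * (\<integral>x. \<bar>x\<bar> powr r \<partial>F) + (1 - 3 / r)"
    using integrable_abs_moment[OF F_moment] prob_space by simp
  also have "\<dots> \<le> 3 / r * b + (1 - 3 / r) * b"
    using r b abs_moment_le by (intro add_mono mult_left_mono) auto
  also have "\<dots> = b" by (simp add: algebra_simps)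
  finally show ?thesis
    using moment_classD[OF F_moment] integrable_third_abs_moment b
    by (simp add: standardised_law_def standardised_law_axioms_def)
qed

lemma char_le_moment_char_class:
  assumes "1 / b < \<bar>t\<bar>"
  shows "cmod (char F t) \<le> \<rho>"
proof -
  have "cmod (char F t) \<le> (SUP t\<in>{t. \<bar>t\<bar> > 1 / b}. cmod (char F t))"
    using assms cmod_char_le_1 by (intro cSUP_upper bdd_aboveI[of _ 1]) auto
  then show ?thesis using F by (simp add: moment_char_class_def)
qed

text \<open>With \<open>z = \<bar>t\<bar>\<bar>x\<bar>\<close> the integrand is \<open>\<bar>x\<bar>\<^sup>3 min 8 z\<close>, and \<open>min 8 z \<le> 8 z\<^sup>r\<^sup>-\<^sup>3\<close> since the
  exponent lies between 0 and 1.\<close>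

lemma remainder3_powr_bound: "remainder3 F t \<le> b / 3 * \<bar>t\<bar> powr (r - 3)"
proof -
  interpret standardised_law F b by (rule standardised_moment_char_class)
  have pt: "min (8 * \<bar>x\<bar> ^ 3) (\<bar>t\<bar> * \<bar>x\<bar> ^ 4) \<le> 8 * \<bar>t\<bar> powr (r - 3) * \<bar>x\<bar> powr r" for x
  proof (cases "x = 0 \<or> t = 0")
    case False
    define z where "z = \<bar>t\<bar> * \<bar>x\<bar>"
    have z: "0 < z" using False by (simp add: z_def)
    have "min 8 z \<le> 8 * z powr (r - 3)"
    proof (cases "z \<le> 1")
      case True
      have "z powr 1 \<le> z powr (r - 3)" using True z r by (intro powr_mono') auto
      then have "z \<le> z powr (r - 3)" using z by simp
      then show ?thesis using powr_ge_zero[of z "r - 3"] by linarith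
    next
      case False
      then have "1 \<le> z powr (r - 3)" using r by (intro ge_one_powr_ge_zero) auto
      then show ?thesis by simp
    qed
    then have "\<bar>x\<bar> ^ 3 * min 8 z \<le> \<bar>x\<bar> ^ 3 * (8 * z powr (r - 3))" by (intro mult_left_mono) auto
    moreover have "\<bar>x\<bar> ^ 3 * min 8 z = min (8 * \<bar>x\<bar> ^ 3) (\<bar>t\<bar> * \<bar>x\<bar> ^ 4)"
    proof -
      have "\<bar>x\<bar> ^ 3 * z = \<bar>t\<bar> * \<bar>x\<bar> ^ 4" unfolding z_def by (simp add: eval_nat_numeral abs_if mult_ac)
      then show ?thesis using mult_min_right[of "\<bar>x\<bar> ^ 3" 8 z] by (simp add: mult.commute)
    qed
    moreover have "\<bar>x\<bar> ^ 3 * (8 * z powr (r - 3)) = 8 * \<bar>t\<bar> powr (r - 3) * \<bar>x\<bar> powr r"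
    proof -
      have "\<bar>x\<bar> ^ 3 = \<bar>x\<bar> powr 3" using False by simp
      then have "\<bar>x\<bar> ^ 3 * \<bar>x\<bar> powr (r - 3) = \<bar>x\<bar> powr (3 + (r - 3))"
        by (simp only: powr_add)
      then have "\<bar>x\<bar> ^ 3 * \<bar>x\<bar> powr (r - 3) = \<bar>x\<bar> powr r" by simp
      then show ?thesis by (simp add: z_def powr_mult mult_ac)
    qed
    ultimately show ?thesis by simp
  qed auto
  have "(\<integral>x. min (8 * \<bar>x\<bar> ^ 3) (\<bar>t\<bar> * \<bar>x\<bar> ^ 4) \<partial>F) \<le> (\<integral>x. 8 * \<bar>t\<bar> powr (r - 3) * \<bar>x\<bar> powr r \<partial>F)"
    using integrable_abs_moment[OF F_moment] by (intro integral_mono integrable_remainder3 pt) auto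
  also have "\<dots> \<le> 8 * \<bar>t\<bar> powr (r - 3) * b"
    using abs_moment_le by (auto intro!: mult_left_mono)
  finally show ?thesis by (simp add: remainder3_def mult_ac)
qed

lemma cubic_error_powr_bound:
  assumes n: "0 < n"
  shows "real n powr ((r - 3) / 2) * cubic_error F n \<le> b / 3 * (LINT s|lborel. exp (- s\<^sup>2 / 3) * (\<bar>s\<bar> ^ 3 + \<bar>s\<bar> ^ 4))"
proof -
  interpret standardised_law F b by (rule standardised_moment_char_class)
  let ?N = "real n powr ((r - 3) / 2)"
  have "?N * cubic_error F n = (LINT s|lborel. ?N * (exp (- s\<^sup>2 / 3) * \<bar>s\<bar> ^ 3 * remainder3 F (s / sqrt n)))"
    unfolding cubic_error_def by simp
  also have "\<dots> \<le> (LINT s|lborel. b / 3 * (exp (- s\<^sup>2 / 3) * (\<bar>s\<bar> ^ 3 + \<bar>s\<bar> ^ 4)))"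
  proof (rule integral_mono)
    show "integrable lborel (\<lambda>s. ?N * (exp (- s\<^sup>2 / 3) * \<bar>s\<bar> ^ 3 * remainder3 F (s / sqrt n)))"
      by (intro integrable_mult_right integrable_cubic_error)
    show "integrable lborel (\<lambda>s. b / 3 * (exp (- s\<^sup>2 / 3) * (\<bar>s\<bar> ^ 3 + \<bar>s\<bar> ^ 4)))"
      unfolding distrib_left by (intro integrable_mult_right Bochner_Integration.integrable_add integrable_gauss_abs_power)
    fix s :: real
    have "?N * remainder3 F (s / sqrt n) \<le> ?N * (b / 3 * \<bar>s / sqrt n\<bar> powr (r - 3))"
      by (intro mult_left_mono remainder3_powr_bound) auto
    also have "\<bar>s / sqrt n\<bar> powr (r - 3) = \<bar>s\<bar> powr (r - 3) / ?N"
    proof -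
      have "sqrt n powr (r - 3) = ?N"
        using n by (simp add: powr_half_sqrt[symmetric] powr_powr)
      then show ?thesis by (simp add: powr_divide abs_divide)
    qed
    also have "?N * (b / 3 * (\<bar>s\<bar> powr (r - 3) / ?N)) = b / 3 * \<bar>s\<bar> powr (r - 3)"
      using n by simp
    also have "\<dots> \<le> b / 3 * (1 + \<bar>s\<bar>)"
    proof (intro mult_left_mono)
      show "\<bar>s\<bar> powr (r - 3) \<le> 1 + \<bar>s\<bar>"
      proof (cases "\<bar>s\<bar> \<le> 1")
        case True
        then have "\<bar>s\<bar> powr (r - 3) \<le> 1" using r by (intro powr_le1) auto
        then show ?thesis by simp
      next
        case False
        then have "\<bar>s\<bar> powr (r - 3) \<le> \<bar>s\<bar> powr 1" using r by (intro powr_mono) auto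
        then show ?thesis using False by simp
      qed
    qed (use b in auto)
    finally have "(exp (- s\<^sup>2 / 3) * \<bar>s\<bar> ^ 3) * (?N * remainder3 F (s / sqrt n)) \<le> (exp (- s\<^sup>2 / 3) * \<bar>s\<bar> ^ 3) * (b / 3 * (1 + \<bar>s\<bar>))"
      by (intro mult_left_mono) auto
    moreover have "\<bar>s\<bar> ^ 3 * (1 + \<bar>s\<bar>) = \<bar>s\<bar> ^ 3 + \<bar>s\<bar> ^ 4" by (simp add: eval_nat_numeral algebra_simps)
    then have "(exp (- s\<^sup>2 / 3) * \<bar>s\<bar> ^ 3) * (b / 3 * (1 + \<bar>s\<bar>)) = b / 3 * (exp (- s\<^sup>2 / 3) * (\<bar>s\<bar> ^ 3 + \<bar>s\<bar> ^ 4))"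
      by (metis mult.assoc mult.left_commute)
    ultimately have "(exp (- s\<^sup>2 / 3) * \<bar>s\<bar> ^ 3) * (?N * remainder3 F (s / sqrt n)) \<le> b / 3 * (exp (- s\<^sup>2 / 3) * (\<bar>s\<bar> ^ 3 + \<bar>s\<bar> ^ 4))"
      by (simp only:)
    then show "?N * (exp (- s\<^sup>2 / 3) * \<bar>s\<bar> ^ 3 * remainder3 F (s / sqrt n)) \<le> b / 3 * (exp (- s\<^sup>2 / 3) * (\<bar>s\<bar> ^ 3 + \<bar>s\<bar> ^ 4))"
      by (simp only: mult_ac)
  qed
  also have "\<dots> = b / 3 * (LINT s|lborel. exp (- s\<^sup>2 / 3) * (\<bar>s\<bar> ^ 3 + \<bar>s\<bar> ^ 4))" by simp
  finally show ?thesis .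
qed

end

text \<open>The term \<open>n\<^sup>-\<^sup>1\<^sup>/\<^sup>2\<close> of the general bound is compatible with the rate \<open>n\<^sup>-\<^sup>(\<^sup>r\<^sup>-\<^sup>3\<^sup>)\<^sup>/\<^sup>2\<close> exactly
  because \<open>r \<le> 4\<close>.\<close>

lemma uniform_remainder_bound:
  fixes r b \<rho> :: real
  assumes r: "3 < r" "r \<le> 4" and b: "1 < b" and \<rho>: "0 < \<rho>" "\<rho> < 1"
  shows "\<exists>q::real. 0 < q \<and> q < 1 \<and> (\<forall>\<Delta>\<^sub>1 > 0.
     limsup (\<lambda>n. SUP F\<in>moment_char_class r b \<rho>. SUP \<Delta>\<in>{q ^ n..\<Delta>\<^sub>1}. SUP x.
               ennreal (real n powr ((r - 3) / 2) * \<bar>remainder F n x \<Delta>\<bar>)) < \<infinity>)"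
proof -
  define q where "q = root 4 \<rho>"
  have q: "0 < q" "q < 1" "q ^ 4 = \<rho>" using \<rho> by (simp_all add: q_def)
  define J where "J = (LINT s|lborel. exp (- s\<^sup>2 / 3) * (\<bar>s\<bar> ^ 3 + \<bar>s\<bar> ^ 4) :: real)"
  have "limsup (\<lambda>n. SUP F\<in>moment_char_class r b \<rho>. SUP \<Delta>\<in>{q ^ n..\<Delta>\<^sub>1}. SUP x.
               ennreal (real n powr ((r - 3) / 2) * \<bar>remainder F n x \<Delta>\<bar>)) < \<infinity>" if \<Delta>\<^sub>1: "0 < \<Delta>\<^sub>1" for \<Delta>\<^sub>1
  proof -
    from edgeworth_remainder_bound[of b q \<Delta>\<^sub>1] b q \<Delta>\<^sub>1 obtain C where C: "0 \<le> C"
      and bound: "\<And>F n x \<Delta>. standardised_law F b \<Longrightarrow> (\<And>t. 1 / b < \<bar>t\<bar> \<Longrightarrow> cmod (char F t) \<le> q ^ 4) \<Longrightarrow>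
        0 < n \<Longrightarrow> q ^ n \<le> \<Delta> \<Longrightarrow> \<Delta> \<le> \<Delta>\<^sub>1 \<Longrightarrow> \<bar>remainder F n x \<Delta>\<bar> \<le> C * (1 / sqrt n + cubic_error F n)"
      by (metis less_imp_le)
    have "real n powr ((r - 3) / 2) * \<bar>remainder F n x \<Delta>\<bar> \<le> C * (1 + b / 3 * J)"
      if n: "0 < n" and F: "F \<in> moment_char_class r b \<rho>" and \<Delta>: "q ^ n \<le> \<Delta>" "\<Delta> \<le> \<Delta>\<^sub>1" for n F x \<Delta>
    proof -
      let ?N = "real n powr ((r - 3) / 2)"
      have "\<bar>remainder F n x \<Delta>\<bar> \<le> C * (1 / sqrt n + cubic_error F n)"
        using standardised_moment_char_class[OF r b F] char_le_moment_char_class[OF r b F] n \<Delta>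
        by (intro bound) (auto simp: q)
      then have "?N * \<bar>remainder F n x \<Delta>\<bar> \<le> ?N * (C * (1 / sqrt n + cubic_error F n))"
        by (intro mult_left_mono) auto
      also have "\<dots> = C * (?N * (1 / sqrt n) + ?N * cubic_error F n)" by (simp add: algebra_simps)
      also have "\<dots> \<le> C * (1 + b / 3 * J)"
      proof (intro mult_left_mono add_mono C)
        have "?N \<le> real n powr (1 / 2)" using n r by (intro powr_mono) auto
        then show "?N * (1 / sqrt n) \<le> 1" using n by (simp add: powr_half_sqrt)
        show "?N * cubic_error F n \<le> b / 3 * J"
          unfolding J_def by (rule cubic_error_powr_bound[OF r b F n])
      qed
      finally show ?thesis .
    qed
    then have "\<forall>\<^sub>F n in sequentially. (SUP F\<in>moment_char_class r b \<rho>. SUP \<Delta>\<in>{q ^ n..\<Delta>\<^sub>1}. SUP x.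
               ennreal (real n powr ((r - 3) / 2) * \<bar>remainder F n x \<Delta>\<bar>)) \<le> ennreal (C * (1 + b / 3 * J))"
      by (intro eventually_sequentiallyI[of 1] SUP_least ennreal_leI) auto
    then have "limsup (\<lambda>n. SUP F\<in>moment_char_class r b \<rho>. SUP \<Delta>\<in>{q ^ n..\<Delta>\<^sub>1}. SUP x.
               ennreal (real n powr ((r - 3) / 2) * \<bar>remainder F n x \<Delta>\<bar>)) \<le> ennreal (C * (1 + b / 3 * J))"
      by (rule Limsup_bounded)
    then show ?thesis by (rule le_less_trans) simp
  qed
  then show ?thesis using q by blast
qed

section \<open>Distributions satisfying the Cramer condition\<close>

text \<open>Equality in the triangle inequality for the integral of \<open>exp(itX)\<close> forces this variable to be almost
  surely constant, so the law lives on a lattice.\<close>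

lemma (in real_distribution) char_multiple_if_modulus_1:
  assumes "cmod (char M t) = 1"
  shows "char M (real k * t) = char M t ^ k"
proof -
  define c where "c = char M t"
  have c: "c * cnj c = 1" using complex_norm_square[of c] assms by (simp add: c_def)
  have int: "integrable M (\<lambda>x. iexp (t * x))" by (intro integrable_iexp) auto
  have "(CLINT x|M. 1 - cnj c * iexp (t * x)) = 1 - cnj c * c"
    using int prob_space by (simp add: c_def char_def)
  then have "(CLINT x|M. 1 - cnj c * iexp (t * x)) = 0" using c by (simp add: mult.commute)
  then have "Re (CLINT x|M. 1 - cnj c * iexp (t * x)) = 0" by simp
  then have i0: "(LINT x|M. Re (1 - cnj c * iexp (t * x))) = 0"
    using int by (subst integral_Re) auto
  have unit: "cmod (cnj c * iexp (t * x)) = 1" for x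
    using assms by (simp add: norm_mult c_def del: of_real_mult)
  have nn: "0 \<le> Re (1 - cnj c * iexp (t * x))" for x
    using complex_Re_le_cmod[of "cnj c * iexp (t * x)"] unit[of x] by simp
  have "AE x in M. Re (1 - cnj c * iexp (t * x)) = 0"
    using i0 nn int by (subst (asm) integral_nonneg_eq_0_iff_AE) auto
  then have "AE x in M. iexp (real k * t * x) = c ^ k"
  proof eventually_elim
    case (elim x)
    then have "Re (cnj c * iexp (t * x)) = 1" by simp
    moreover have "cmod (cnj c * iexp (t * x)) = 1" by (rule unit)
    ultimately have "cnj c * iexp (t * x) = 1"
      by (smt (verit) cmod_power2 complex_eqI one_complex.simps one_power2 power2_eq_square zero_eq_power2)
    then have "c * (cnj c * iexp (t * x)) = c" by simp
    then have "iexp (t * x) = c" using c by (simp add: mult.assoc[symmetric])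
    then have "iexp (t * x) ^ k = c ^ k" by simp
    then show ?case by (simp add: exp_of_nat_mult[symmetric] mult_ac)
  qed
  then have "char M (real k * t) = (CLINT x|M. c ^ k)"
    unfolding char_def by (intro integral_cong_AE) auto
  then show ?thesis using prob_space by (simp add: c_def)
qed

context
  fixes F :: "real measure"
  assumes F: "F \<in> cramer_class 3"
begin

lemma F_moment3: "F \<in> moment_class 3 \<infinity>"
  using F by (simp add: cramer_class_def)

interpretation real_distribution F by (rule moment_classD[OF F_moment3])

lemma standardised_cramer_class: "standardised_law F (max 1 (\<integral>x. \<bar>x\<bar> ^ 3 \<partial>F))"
  using moment_classD[OF F_moment3] integrable_abs_moment[OF F_moment3]
  by (simp add: standardised_law_def standardised_law_axioms_def)

text \<open>Beyond some \<open>T\<close> the condition on the limes superior applies, and on the compact remaining set the modulus attains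
  its maximum. The maximum is below 1, since otherwise the modulus would equal 1 at all multiples of the maximiser
  and thus at arbitrarily high frequencies. The definition of \<open>\<rho>\<close> includes \<open>1/2\<close> to make it positive.\<close>

lemma char_bounded_away:
  assumes "0 < \<epsilon>"
  obtains \<rho> where "0 < \<rho>" "\<rho> < 1" "\<And>t. \<epsilon> < \<bar>t\<bar> \<Longrightarrow> cmod (char F t) \<le> \<rho>"
proof -
  have "Limsup at_infinity (\<lambda>t. ereal (cmod (char F t))) < 1" using F by (simp add: cramer_class_def)
  then obtain y where y: "Limsup at_infinity (\<lambda>t. ereal (cmod (char F t))) < y" "y < 1"
    using dense by blast
  have "\<forall>\<^sub>F t in at_infinity. ereal (cmod (char F t)) < y" by (rule Limsup_lessD[OF y(1)])
  then obtain T where T: "\<And>t. T \<le> \<bar>t\<bar> \<Longrightarrow> ereal (cmod (char F t)) < y"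
    unfolding eventually_at_infinity by auto
  define \<rho>1 where "\<rho>1 = real_of_ereal y"
  have "ereal (cmod (char F \<bar>T\<bar>)) < y" using T[of "\<bar>T\<bar>"] by simp
  then have y1: "y = ereal \<rho>1" using y(2) by (cases y) (auto simp: \<rho>1_def)
  have \<rho>1: "\<rho>1 < 1" "\<And>t. T \<le> \<bar>t\<bar> \<Longrightarrow> cmod (char F t) < \<rho>1"
    using y(2) T by (simp_all add: y1)
  have lt1: "cmod (char F t) < 1" if "t \<noteq> 0" for t
  proof (rule ccontr)
    assume "\<not> cmod (char F t) < 1"
    then have 1: "cmod (char F t) = 1" using cmod_char_le_1[of t] by linarith
    obtain k :: nat where "T / \<bar>t\<bar> \<le> k" using real_arch_simple by blast
    then have "T \<le> \<bar>real k * t\<bar>" using that by (simp add: abs_mult field_simps)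
    then have "cmod (char F (real k * t)) < 1" using \<rho>1 by force
    then show False using char_multiple_if_modulus_1[OF 1, of k] 1 by (simp add: norm_power)
  qed
  define S where "S = {t. \<epsilon> \<le> \<bar>t\<bar> \<and> \<bar>t\<bar> \<le> max \<epsilon> T}"
  have "compact S"
  proof -
    have "closed S" unfolding S_def by (intro closed_Collect_conj closed_Collect_le continuous_intros)
    moreover have "bounded S" unfolding S_def by (auto intro!: boundedI)
    ultimately show ?thesis by (simp add: compact_eq_bounded_closed)
  qed
  moreover have "\<epsilon> \<in> S" using assms by (simp add: S_def)
  then have "S \<noteq> {}" by blast
  moreover have "continuous_on S (\<lambda>t. cmod (char F t))"
    by (intro continuous_on_norm continuous_at_imp_continuous_on ballI isCont_char)
  ultimately have "\<exists>t0\<in>S. \<forall>t\<in>S. cmod (char F t) \<le> cmod (char F t0)"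
    by (rule continuous_attains_sup)
  then obtain t0 where t0: "t0 \<in> S" "\<And>t. t \<in> S \<Longrightarrow> cmod (char F t) \<le> cmod (char F t0)"
    by blast
  have "t0 \<noteq> 0" using t0(1) assms by (auto simp: S_def)
  define \<rho> where "\<rho> = max (1 / 2) (max \<rho>1 (cmod (char F t0)))"
  show thesis
  proof
    show "0 < \<rho>" "\<rho> < 1" using \<rho>1(1) lt1[OF \<open>t0 \<noteq> 0\<close>] by (auto simp: \<rho>_def)
    fix t assume "\<epsilon> < \<bar>t\<bar>"
    then show "cmod (char F t) \<le> \<rho>"
      using \<rho>1(2)[of t] t0(2)[of t] by (cases "T \<le> \<bar>t\<bar>") (auto simp: S_def \<rho>_def)
  qed
qed

lemma remainder3_tendsto_0:
  assumes X: "X \<longlonglongrightarrow> (0 :: real)"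
  shows "(\<lambda>n. remainder3 F (X n)) \<longlonglongrightarrow> 0"
proof -
  have "(\<lambda>n. \<integral>x. min (8 * \<bar>x\<bar> ^ 3) (\<bar>X n\<bar> * \<bar>x\<bar> ^ 4) \<partial>F) \<longlonglongrightarrow> (\<integral>x. 0 \<partial>F)"
  proof (rule integral_dominated_convergence)
    show "integrable F (\<lambda>x. 8 * \<bar>x\<bar> ^ 3)"
      using integrable_abs_moment[OF F_moment3] by simp
    show "AE x in F. (\<lambda>n. min (8 * \<bar>x\<bar> ^ 3) (\<bar>X n\<bar> * \<bar>x\<bar> ^ 4)) \<longlonglongrightarrow> 0"
    proof (rule AE_I2)
      fix x :: real
      have "(\<lambda>n. min (8 * \<bar>x\<bar> ^ 3) (\<bar>X n\<bar> * \<bar>x\<bar> ^ 4)) \<longlonglongrightarrow> min (8 * \<bar>x\<bar> ^ 3) (\<bar>0\<bar> * \<bar>x\<bar> ^ 4)"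
        by (intro tendsto_intros X)
      then show "(\<lambda>n. min (8 * \<bar>x\<bar> ^ 3) (\<bar>X n\<bar> * \<bar>x\<bar> ^ 4)) \<longlonglongrightarrow> 0" by simp
    qed
    show "AE x in F. norm (min (8 * \<bar>x\<bar> ^ 3) (\<bar>X n\<bar> * \<bar>x\<bar> ^ 4)) \<le> 8 * \<bar>x\<bar> ^ 3" for n
      by (intro AE_I2) auto
  qed auto
  then show ?thesis
    unfolding remainder3_def[abs_def] by (intro tendsto_divide_zero) simp
qed

lemma cubic_error_tendsto_0: "cubic_error F \<longlonglongrightarrow> 0"
proof -
  define b where "b = max 1 (\<integral>x. \<bar>x\<bar> ^ 3 \<partial>F)"
  interpret S: standardised_law F b unfolding b_def by (rule standardised_cramer_class)
  let ?h = "\<lambda>n s. exp (- s\<^sup>2 / 3) * \<bar>s\<bar> ^ 3 * remainder3 F (s / sqrt (real n))"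
  have "(\<lambda>n. LINT s|lborel. ?h n s) \<longlonglongrightarrow> (LINT (s::real)|lborel. 0)"
  proof (rule integral_dominated_convergence)
    show "integrable lborel (\<lambda>s. exp (- s\<^sup>2 / 3) * \<bar>s\<bar> ^ 3 * (b / 3))"
      by (intro integrable_mult_left integrable_gauss_abs_power)
    show "AE s in lborel. norm (?h n s) \<le> exp (- s\<^sup>2 / 3) * \<bar>s\<bar> ^ 3 * (b / 3)" for n
      using S.remainder3_nonneg S.remainder3_le
      by (intro AE_I2) (simp add: abs_mult mult_left_mono)
    show "AE s in lborel. (\<lambda>n. ?h n s) \<longlonglongrightarrow> 0"
    proof (rule AE_I2)
      fix s :: real
      have "(\<lambda>n. s / sqrt (real n)) \<longlonglongrightarrow> 0"
        by (intro tendsto_divide_0[OF tendsto_const] filterlim_at_top_imp_at_infinity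
            filterlim_compose[OF sqrt_at_top] filterlim_real_sequentially)
      then show "(\<lambda>n. ?h n s) \<longlonglongrightarrow> 0"
        by (intro tendsto_mult_right_zero remainder3_tendsto_0)
    qed
  qed (simp_all add: S.remainder3_measurable)
  then show ?thesis by (simp add: cubic_error_def[abs_def])
qed

lemma remainder_tendsto_0:
  "\<exists>q::real. 0 < q \<and> q < 1 \<and> (\<forall>\<Delta>\<^sub>1 > 0.
     (\<lambda>n. SUP \<Delta>\<in>{q ^ n..\<Delta>\<^sub>1}. SUP x. ennreal \<bar>remainder F n x \<Delta>\<bar>) \<longlonglongrightarrow> 0)"
proof -
  define b where "b = max 1 (\<integral>x. \<bar>x\<bar> ^ 3 \<partial>F)"
  interpret S: standardised_law F b unfolding b_def by (rule standardised_cramer_class)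
  have b0: "0 < 1 / b" using S.b_ge_1 by simp
  from char_bounded_away[OF b0] obtain \<rho> where \<rho>: "0 < \<rho>" "\<rho> < 1" "\<And>t. 1 / b < \<bar>t\<bar> \<Longrightarrow> cmod (char F t) \<le> \<rho>" by blast
  define q where "q = root 4 \<rho>"
  have q: "0 < q" "q < 1" "q ^ 4 = \<rho>" using \<rho> by (simp_all add: q_def)
  have "(\<lambda>n. SUP \<Delta>\<in>{q ^ n..\<Delta>\<^sub>1}. SUP x. ennreal \<bar>remainder F n x \<Delta>\<bar>) \<longlonglongrightarrow> 0" if \<Delta>\<^sub>1: "0 < \<Delta>\<^sub>1" for \<Delta>\<^sub>1
  proof -
    from edgeworth_remainder_bound[OF S.b_ge_1 q(1,2) \<Delta>\<^sub>1] obtain C where C: "0 \<le> C"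
      and bound: "\<And>n x \<Delta>. 0 < n \<Longrightarrow> q ^ n \<le> \<Delta> \<Longrightarrow> \<Delta> \<le> \<Delta>\<^sub>1 \<Longrightarrow> \<bar>remainder F n x \<Delta>\<bar> \<le> C * (1 / sqrt n + cubic_error F n)"
      using S.standardised_law_axioms \<rho>(3) q(3) by metis
    have "(\<lambda>n. C * (1 / sqrt (real n) + cubic_error F n)) \<longlonglongrightarrow> C * (0 + 0)"
      by (intro tendsto_intros cubic_error_tendsto_0 tendsto_divide_0[OF tendsto_const] filterlim_at_top_imp_at_infinity
              filterlim_compose[OF sqrt_at_top] filterlim_real_sequentially)
    then have lim: "(\<lambda>n. ennreal (C * (1 / sqrt (real n) + cubic_error F n))) \<longlonglongrightarrow> ennreal 0"
      by (intro tendsto_ennrealI) simp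
    have le: "\<forall>\<^sub>F n in sequentially. (SUP \<Delta>\<in>{q ^ n..\<Delta>\<^sub>1}. SUP x. ennreal \<bar>remainder F n x \<Delta>\<bar>)
        \<le> ennreal (C * (1 / sqrt (real n) + cubic_error F n))"
      by (intro eventually_sequentiallyI[of 1] SUP_least ennreal_leI bound) auto
    show ?thesis
      by (rule tendsto_sandwich[OF _ le tendsto_const]) (use lim in auto)
  qed
  then show ?thesis using q by blast
qed

end

theorem theorem1:
  shows "(\<forall>F \<in> cramer_class 3. \<exists>q::real. 0 < q \<and> q < 1 \<and>
            (\<forall>\<Delta>\<^sub>1 > 0.
              (\<lambda>n. SUP \<Delta>\<in>{q ^ n..\<Delta>\<^sub>1}. SUP x. ennreal \<bar>remainder F n x \<Delta>\<bar>) \<longlonglongrightarrow> 0))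
       \<and>
         (\<forall>(r::real) (b::real) (\<rho>::real).
            3 < r \<longrightarrow> r \<le> 4 \<longrightarrow> 1 < b \<longrightarrow> 0 < \<rho> \<longrightarrow> \<rho> < 1 \<longrightarrow>
            (\<exists>q::real. 0 < q \<and> q < 1 \<and>
              (\<forall>\<Delta>\<^sub>1 > 0.
                limsup (\<lambda>n. SUP F\<in>moment_char_class r b \<rho>. SUP \<Delta>\<in>{q ^ n..\<Delta>\<^sub>1}. SUP x.
                          ennreal (real n powr ((r - 3) / 2) * \<bar>remainder F n x \<Delta>\<bar>)) < \<infinity>)))"
  using remainder_tendsto_0 uniform_remainder_bound by blast

end
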